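(* Let $C_n$ be the cycle on $n\geq 4$ vertices. Then \[\frac{n}{8}\left(1-O\left(\frac{\log n}{n}\right)\right)\leq \mathrm{dct}(C_n)\leq \frac{n+1}{8}.\] In particular $\mathrm{dct}(C_n)=(1+o(1))n/8$ and the cost of drunkenness satisfies $F(C_n)=\mathrm{ct}(C_n)/\mathrm{dct}(C_n)=2+o(1)$, where asymptotics are as $n\to\infty$.
   Context: Cops and robber game on a finite connected graph $G=(V,E)$ with $k$ cops: in round $0$ the cops choose positions $x\in V^k$, then the robber chooses his initial vertex; in each round $t\ge1$ first each cop moves along an edge or stays, then the robber moves. Capture time $T$ is the first time a cop and the robber occupy the same vertex. The cop number $c(G)$ is the minimum $k$ for which the cops can guarantee capture of a robber who sees everything and plays optimally. $\mathrm{ct}_{x,y}(G,k)$ is the capture time from $(x,y)$ under optimal play (cops minimizing, robber maximizing); $\mathrm{ct}(G,k)=\min_{x}\max_{y}\mathrm{ct}_{x,y}(G,k)$ and $\mathrm{ct}(G)=\mathrm{ct}(G,c(G))$. In the drunk robber version, after the cops choose $x$ the robber's initial vertex is uniformly random in $V$, and in each round the robber moves to a uniformly random neighbour of his current vertex (open neighbourhood; he never stays), independently of the cops; the cops see him. $\mathrm{dct}_{x,y}(G,k)$ is the expected capture time from $(x,y)$ when the cops play to minimize it, $\mathrm{dct}(G,k)=\min_{x\in V^k}\frac{1}{|V|}\sum_{y\in V}\mathrm{dct}_{x,y}(G,k)$, $\mathrm{dct}(G)=\mathrm{dct}(G,c(G))$, and $F(G)=\mathrm{ct}(G)/\mathrm{dct}(G)$.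 For the cycle, $c(C_n)=2$. *)

theory Defs
  imports "HOL-Probability.Probability" "HOL-Library.Landau_Symbols"
begin

section \<open>Graphs\<close>

text \<open>A simple graph is a pair of a vertex set and a set of edges, each edge being an
  unordered pair of vertices.\<close>

type_synonym 'a graph = "'a set \<times> 'a set set"

abbreviation verts :: "'a graph \<Rightarrow> 'a set" where
  "verts G \<equiv> fst G"

abbreviation edges :: "'a graph \<Rightarrow> 'a set set" where
  "edges G \<equiv> snd G"

definition nbrs :: "'a graph \<Rightarrow> 'a \<Rightarrow> 'a set" where
  "nbrs G v = {u \<in> verts G. {v, u} \<in> edges G}"

definition closed_nbrs :: "'a graph \<Rightarrow> 'a \<Rightarrow> 'a set" where
  "closed_nbrs G v = insert v (nbrs G v)"

text \<open>This is the cycle only for \<open>n \<ge> 3\<close>.\<close>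

definition cycle_graph :: "nat \<Rightarrow> nat graph" where
  "cycle_graph n = ({0..<n}, (\<lambda>i. {i, Suc i mod n}) ` {0..<n})"


section \<open>Playing the game\<close>

text \<open>The positions of \<open>k\<close> cops are a list of length \<open>k\<close>.\<close>

definition cop_positions :: "'a graph \<Rightarrow> nat \<Rightarrow> 'a list set" where
  "cop_positions G k = {x. length x = k \<and> set x \<subseteq> verts G}"

text \<open>A history lists the positions \<open>(x\<^sub>s, y\<^sub>s)\<close> of the cops and the robber at the end of
  the rounds \<open>s = 0, \<dots>, t\<close>; it is never empty. The robber moves after the cops, so
  his strategy also takes the positions that the cops have just moved to.\<close>

type_synonym 'a history = "('a list \<times> 'a) list"
type_synonym 'a cop_strategy = "'a history \<Rightarrow> 'a list"
type_synonym 'a robber_strategy = "'a history \<Rightarrow> 'a list \<Rightarrow> 'a"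

definition cop_strategies :: "'a graph \<Rightarrow> 'a cop_strategy set" where
  "cop_strategies G =
     {\<sigma>. \<forall>h x y. set x \<subseteq> verts G \<and> y \<in> verts G \<longrightarrow>
            list_all2 (\<lambda>u u'. u' \<in> closed_nbrs G u) x (\<sigma> (h @ [(x, y)]))}"

definition robber_strategies :: "'a graph \<Rightarrow> 'a robber_strategy set" where
  "robber_strategies G =
     {\<rho>. \<forall>h x y x'. set x \<subseteq> verts G \<and> y \<in> verts G \<and> set x' \<subseteq> verts G \<longrightarrow>
            \<rho> (h @ [(x, y)]) x' \<in> closed_nbrs G y}"

primrec play :: "'a cop_strategy \<Rightarrow> 'a robber_strategy \<Rightarrow> 'a list \<Rightarrow> 'a \<Rightarrow> nat \<Rightarrow> 'a history" where
  "play \<sigma> \<rho> x y 0 = [(x, y)]"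
| "play \<sigma> \<rho> x y (Suc t) =
     (let h = play \<sigma> \<rho> x y t; x' = \<sigma> h in h @ [(x', \<rho> h x')])"

definition cops_at :: "'a cop_strategy \<Rightarrow> 'a robber_strategy \<Rightarrow> 'a list \<Rightarrow> 'a \<Rightarrow> nat \<Rightarrow> 'a list" where
  "cops_at \<sigma> \<rho> x y t = fst (last (play \<sigma> \<rho> x y t))"

definition robber_at :: "'a cop_strategy \<Rightarrow> 'a robber_strategy \<Rightarrow> 'a list \<Rightarrow> 'a \<Rightarrow> nat \<Rightarrow> 'a" where
  "robber_at \<sigma> \<rho> x y t = snd (last (play \<sigma> \<rho> x y t))"

text \<open>In a round \<open>t \<ge> 1\<close> the robber is caught either when a cop moves onto his previous vertex
  or when he himself moves onto a cop.\<close>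

definition caught :: "'a cop_strategy \<Rightarrow> 'a robber_strategy \<Rightarrow> 'a list \<Rightarrow> 'a \<Rightarrow> nat \<Rightarrow> bool" where
  "caught \<sigma> \<rho> x y t \<longleftrightarrow>
     robber_at \<sigma> \<rho> x y t \<in> set (cops_at \<sigma> \<rho> x y t) \<or>
     (t > 0 \<and> robber_at \<sigma> \<rho> x y (t - 1) \<in> set (cops_at \<sigma> \<rho> x y t))"

definition capture_time :: "'a cop_strategy \<Rightarrow> 'a robber_strategy \<Rightarrow> 'a list \<Rightarrow> 'a \<Rightarrow> enat" where
  "capture_time \<sigma> \<rho> x y = (INF t \<in> {t. caught \<sigma> \<rho> x y t}. enat t)"


section \<open>The adversarial robber\<close>

definition cops_win :: "'a graph \<Rightarrow> nat \<Rightarrow> bool" where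
  "cops_win G k \<longleftrightarrow>
     (\<exists>x \<in> cop_positions G k. \<exists>\<sigma> \<in> cop_strategies G. \<forall>y \<in> verts G. \<forall>\<rho> \<in> robber_strategies G.
        capture_time \<sigma> \<rho> x y < \<infinity>)"

definition cop_number :: "'a graph \<Rightarrow> nat" where
  "cop_number G = (LEAST k. cops_win G k)"

definition ct_from :: "'a graph \<Rightarrow> 'a list \<Rightarrow> 'a \<Rightarrow> enat" where
  "ct_from G x y =
     (INF \<sigma> \<in> cop_strategies G. SUP \<rho> \<in> robber_strategies G. capture_time \<sigma> \<rho> x y)"

definition ct_with :: "'a graph \<Rightarrow> nat \<Rightarrow> enat" where
  "ct_with G k = (INF x \<in> cop_positions G k. SUP y \<in> verts G. ct_from G x y)"

definition ct :: "'a graph \<Rightarrow> enat" where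
  "ct G = ct_with G (cop_number G)"


section \<open>The drunk robber\<close>

text \<open>The simple random walk started at \<open>y\<close> is the measure on trajectories which the
  Ionescu-Tulcea theorem yields from the one-step distributions: \<open>walk_step G y i \<omega>\<close> is the law
  of the position at time \<open>i\<close>, given the positions \<open>\<omega> j\<close> at the times \<open>j < i\<close>.\<close>

definition walk_step :: "'a graph \<Rightarrow> 'a \<Rightarrow> nat \<Rightarrow> (nat \<Rightarrow> 'a) \<Rightarrow> 'a measure" where
  "walk_step G y i \<omega> =
     measure_pmf (case i of 0 \<Rightarrow> return_pmf y | Suc j \<Rightarrow> pmf_of_set (nbrs G (\<omega> j)))"

lemma Ionescu_Tulcea_walk_step: "Ionescu_Tulcea (walk_step G y) (\<lambda>_. count_space UNIV)"
proof (rule Ionescu_Tulcea.intro)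
  fix i
  have *: "measure_pmf p \<in> space (subprob_algebra (count_space UNIV))" for p :: "'a pmf"
    by (simp add: space_subprob_algebra measure_pmf.subprob_space_axioms)
  show "walk_step G y i \<in> Pi\<^sub>M {0..<i} (\<lambda>_. count_space UNIV) \<rightarrow>\<^sub>M subprob_algebra (count_space UNIV)"
  proof (cases i)
    case 0
    then show ?thesis
      using * by (simp add: walk_step_def[abs_def])
  next
    case (Suc j)
    have "(\<lambda>v. measure_pmf (pmf_of_set (nbrs G v)))
            \<in> count_space UNIV \<rightarrow>\<^sub>M subprob_algebra (count_space UNIV)"
      using * by simp
    moreover have "(\<lambda>\<omega>. \<omega> j) \<in> Pi\<^sub>M {0..<i} (\<lambda>_. count_space UNIV) \<rightarrow>\<^sub>M count_space UNIV"
      using Suc by (intro measurable_component_singleton) simp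
    ultimately show ?thesis
      unfolding walk_step_def[abs_def] using Suc
      by (auto dest: measurable_compose)
  qed
qed (simp add: walk_step_def measure_pmf.prob_space_axioms)

definition walk_measure :: "'a graph \<Rightarrow> 'a \<Rightarrow> (nat \<Rightarrow> 'a) measure" where
  "walk_measure G y =
     projective_family.lim UNIV
       (Ionescu_Tulcea.CI (walk_step G y) (\<lambda>_. count_space UNIV)) (\<lambda>_. count_space UNIV)"

text \<open>The robber who follows a trajectory \<open>\<omega>\<close> whatever the cops do; a history of length \<open>t\<close>
  precedes his move in round \<open>t\<close>.\<close>

definition drunk :: "(nat \<Rightarrow> 'a) \<Rightarrow> 'a robber_strategy" where
  "drunk \<omega> = (\<lambda>h x'. \<omega> (length h))"

definition dct_from :: "'a graph \<Rightarrow> 'a list \<Rightarrow> 'a \<Rightarrow> ennreal" where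
  "dct_from G x y =
     (INF \<sigma> \<in> cop_strategies G.
        \<integral>\<^sup>+ \<omega>. ennreal_of_enat (capture_time \<sigma> (drunk \<omega>) x y) \<partial>walk_measure G y)"

definition dct_with :: "'a graph \<Rightarrow> nat \<Rightarrow> ennreal" where
  "dct_with G k =
     (INF x \<in> cop_positions G k. (\<Sum>y \<in> verts G. dct_from G x y) / of_nat (card (verts G)))"

definition dct :: "'a graph \<Rightarrow> ennreal" where
  "dct G = dct_with G (cop_number G)"

definition cost_of_drunkenness :: "'a graph \<Rightarrow> ennreal" where
  "cost_of_drunkenness G = ennreal_of_enat (ct G) / dct G"

end

theory Submission
  imports Defs "HOL-Number_Theory.Cong" "HOL-Real_Asymp.Real_Asymp"
begin

text \<open>
  Lift the play to the integers, so that the robber sits in an arc between two cops, at distances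
  \<open>a\<close> and \<open>b\<close> from its ends, and the drunk robber performs a simple random walk \<open>W\<close>.

  Upper bound: if the nearer cop just keeps walking towards the robber, then their distance drops by
  \<open>1\<close> per round on average, so the expected capture time is at most \<open>min a b\<close>; for antipodal
  cops the average of \<open>min a b\<close> over the vertices is at most \<open>(n + 1) / 8\<close>.

  Lower bound: a cop moves at speed at most \<open>1\<close>, so whatever the cops do, the capture time satisfies
  \<open>T + 1 \<ge> min (a + W\<^sub>T) (b - W\<^sub>T)\<close>. With \<open>D = \<bar>a - b\<bar>\<close>, the right-hand side is at least
  \<open>min a b \<plusminus> W\<^sub>T - W\<^sub>T\<^sup>2 / D\<close>, and optional stopping (\<open>E W\<^sub>T = 0\<close> and \<open>E W\<^sub>T\<^sup>2 = E T\<close>) yields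
  \<open>E T \<ge> (min a b - 1) D / (D + 1)\<close>. Summing over the vertices, the factor \<open>D / (D + 1)\<close> costs
  only a harmonic sum, whence the \<open>O(log n)\<close>.

  Against the adversarial robber, two antipodal cops squeeze the arc that contains him, and a robber
  who sits still in the middle of the larger arc survives for about \<open>n / 4\<close> rounds.
\<close>

section \<open>The random walk\<close>

text \<open>Adaptedness to the natural filtration, phrased without sigma-algebras. What is known at
  the end of round \<open>t\<close> depends on \<open>\<omega> 0\<close> up to
  \<open>\<omega> t\<close> and is therefore \<open>determined (Suc t)\<close>.\<close>

definition determined :: "nat \<Rightarrow> ((nat \<Rightarrow> 'a) \<Rightarrow> 'b) \<Rightarrow> bool" where
  "determined m F \<longleftrightarrow> (\<forall>\<omega> \<omega>'. (\<forall>i<m. \<omega> i = \<omega>' i) \<longrightarrow> F \<omega> = F \<omega>')"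

lemma determinedD: "determined m F \<Longrightarrow> (\<And>i. i < m \<Longrightarrow> \<omega> i = \<omega>' i) \<Longrightarrow> F \<omega> = F \<omega>'"
  unfolding determined_def by blast

lemma determined_mono: "determined m F \<Longrightarrow> m \<le> k \<Longrightarrow> determined k F"
  unfolding determined_def by (meson less_le_trans)

lemma determined_comp: "determined m F \<Longrightarrow> determined m (\<lambda>\<omega>. g (F \<omega>))"
  unfolding determined_def by metis

lemma determined_times:
  fixes F :: "(nat \<Rightarrow> 'a) \<Rightarrow> 'b :: times"
  shows "determined m F \<Longrightarrow> determined m H \<Longrightarrow> determined m (\<lambda>\<omega>. F \<omega> * H \<omega>)"
  unfolding determined_def by metis

lemma determined_sum:
  fixes F :: "'i \<Rightarrow> (nat \<Rightarrow> 'a) \<Rightarrow> 'b :: comm_monoid_add"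
  assumes "\<And>i. i \<in> A \<Longrightarrow> determined m (F i)"
  shows "determined m (\<lambda>\<omega>. \<Sum>i\<in>A. F i \<omega>)"
  unfolding determined_def
proof (intro allI impI sum.cong refl)
  fix \<omega> \<omega>' :: "nat \<Rightarrow> 'a" and i assume "\<forall>i<m. \<omega> i = \<omega>' i" "i \<in> A"
  then show "F i \<omega> = F i \<omega>'" by (intro determinedD[OF assms]) simp_all
qed

text \<open>A finite product of countable discrete spaces is again discrete. This is where the
  measurability of every event of the game comes from.\<close>

lemma measurable_determined_PiM:
  fixes F :: "(nat \<Rightarrow> 'a :: countable) \<Rightarrow> 'b"
  assumes "range F \<subseteq> space N"
  shows "F \<in> PiM {0..<m} (\<lambda>_. count_space UNIV) \<rightarrow>\<^sub>M N"
proof -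
  have "PiM {0..<m} (\<lambda>_. count_space (UNIV :: 'a set)) = count_space (PiE {0..<m} (\<lambda>_. UNIV))"
    by (rule count_space_PiM_finite) auto
  then show ?thesis using assms by auto
qed

lemma sets_walk_measure [measurable_cong]:
  "sets (walk_measure G y) = sets (PiM UNIV (\<lambda>_. count_space UNIV))"
proof -
  interpret Ionescu_Tulcea "walk_step G y" "\<lambda>_. count_space UNIV"
    by (rule Ionescu_Tulcea_walk_step)
  show ?thesis unfolding walk_measure_def by simp
qed

lemma space_walk_measure [simp]: "space (walk_measure G y) = UNIV"
  using sets_eq_imp_space_eq[OF sets_walk_measure[of G y]] by (simp add: space_PiM)

lemma measurable_determined:
  fixes F :: "(nat \<Rightarrow> 'a :: countable) \<Rightarrow> 'b"
  assumes "determined m F" "range F \<subseteq> space N"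
  shows "F \<in> walk_measure G y \<rightarrow>\<^sub>M N"
proof -
  have "(\<lambda>\<omega>. F (restrict \<omega> {0..<m})) \<in> PiM UNIV (\<lambda>_. count_space UNIV) \<rightarrow>\<^sub>M N"
    by (rule measurable_compose[OF _ measurable_determined_PiM]) (use assms in measurable)
  moreover have "(\<lambda>\<omega>. F (restrict \<omega> {0..<m})) = F"
    by (rule ext, rule determinedD[OF assms(1)]) simp
  ultimately show ?thesis
    by (simp add: measurable_cong_sets[OF sets_walk_measure refl])
qed

section \<open>Integrating out the walk one step at a time\<close>

context
  fixes G :: "'a :: countable graph" and y :: 'a
begin

interpretation IT: Ionescu_Tulcea "walk_step G y" "\<lambda>_. count_space UNIV"
  by (rule Ionescu_Tulcea_walk_step)

text \<open>The projective limit has the finite kernel composition \<open>IT.C 0 m\<close> as its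
  marginal on the first \<open>m\<close> coordinates, and a determined functional sees only that
  marginal.\<close>

lemma nn_integral_walk_C:
  fixes F :: "(nat \<Rightarrow> 'a) \<Rightarrow> ennreal"
  assumes F: "determined m F"
  shows "(\<integral>\<^sup>+ \<omega>. F \<omega> \<partial>walk_measure G y) = (\<integral>\<^sup>+ \<omega>. F \<omega> \<partial>IT.C 0 m (\<lambda>_. undefined))"
proof -
  \<comment> \<open>\<open>IT.CI\<close> is built from the least time that bounds its index set; for
    \<open>{0..<m}\<close> this time is \<open>m\<close>.\<close>
  have up: "IT.up_to {0..<m} = m"
  proof (rule antisym)
    show "IT.up_to {0..<m} \<le> m" by (simp add: IT.up_to_iff)
    show "m \<le> IT.up_to {0..<m}" using IT.up_to[of "{0..<m}"] by (cases m) auto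
  qed
  have CI: "IT.CI {0..<m} = IT.C 0 m (\<lambda>_. undefined)"
    unfolding IT.CI_def up using IT.distr_C[of m m "\<lambda>_. undefined" 0] by simp
  have [measurable]: "F \<in> borel_measurable (PiM {0..<m} (\<lambda>_. count_space UNIV))"
    by (rule measurable_determined_PiM) simp
  have "(\<integral>\<^sup>+ \<omega>. F \<omega> \<partial>walk_measure G y) = (\<integral>\<^sup>+ \<omega>. F (restrict \<omega> {0..<m}) \<partial>walk_measure G y)"
    by (intro nn_integral_cong determinedD[OF F]) simp
  also have "\<dots> = (\<integral>\<^sup>+ \<omega>. F \<omega> \<partial>distr IT.PF.lim (PiM {0..<m} (\<lambda>_. count_space UNIV)) (\<lambda>x. restrict x {0..<m}))"
    unfolding walk_measure_def
    by (subst nn_integral_distr) (auto simp: measurable_cong_sets[OF IT.PF.sets_lim refl])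
  finally show ?thesis
    by (simp add: IT.distr_lim CI)
qed

lemma nn_integral_C_Suc:
  fixes F :: "(nat \<Rightarrow> 'a) \<Rightarrow> ennreal"
  shows "(\<integral>\<^sup>+ \<omega>. F \<omega> \<partial>IT.C 0 (Suc m) (\<lambda>_. undefined)) =
    (\<integral>\<^sup>+ \<omega>. (\<integral>\<^sup>+ v. F (fun_upd \<omega> m v) \<partial>walk_step G y m \<omega>) \<partial>IT.C 0 m (\<lambda>_. undefined))"
proof -
  have [measurable]: "F \<in> borel_measurable (PiM {0..<k} (\<lambda>_. count_space UNIV))" for k
    by (rule measurable_determined_PiM) simp
  have u: "(\<lambda>_. undefined) \<in> space (PiM {0..<0} (\<lambda>_. count_space (UNIV :: 'a set)))"
    by (simp add: space_PiM PiE_def extensional_def)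
  have C: "sets (IT.C 0 m (\<lambda>_. undefined)) = sets (PiM {0..<m} (\<lambda>_. count_space UNIV))"
    using IT.sets_C[OF u, of m] by simp
  have "(\<integral>\<^sup>+ \<omega>. F \<omega> \<partial>IT.C 0 (Suc m) (\<lambda>_. undefined)) =
    (\<integral>\<^sup>+ \<omega>. (\<integral>\<^sup>+ \<omega>'. F \<omega>' \<partial>IT.eP m \<omega>) \<partial>IT.C 0 m (\<lambda>_. undefined))"
    by (simp, rule nn_integral_bind[where B="PiM {0 ..< Suc m} (\<lambda>_. count_space UNIV)"])
      (simp_all add: measurable_cong_sets[OF C refl])
  also have "\<dots> = (\<integral>\<^sup>+ \<omega>. (\<integral>\<^sup>+ v. F (fun_upd \<omega> m v) \<partial>walk_step G y m \<omega>) \<partial>IT.C 0 m (\<lambda>_. undefined))"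
    by (intro nn_integral_cong IT.nn_integral_eP) (simp_all add: sets_eq_imp_space_eq[OF C])
  finally show ?thesis .
qed

lemma nn_integral_walk_0:
  fixes F :: "(nat \<Rightarrow> 'a) \<Rightarrow> ennreal"
  assumes F: "determined (Suc 0) F"
  shows "(\<integral>\<^sup>+ \<omega>. F \<omega> \<partial>walk_measure G y) = F (\<lambda>_. y)"
proof -
  have "(\<integral>\<^sup>+ \<omega>. F \<omega> \<partial>walk_measure G y) =
    (\<integral>\<^sup>+ \<omega>. F (fun_upd \<omega> 0 y) \<partial>IT.C 0 0 (\<lambda>_. undefined))"
    unfolding nn_integral_walk_C[OF F] nn_integral_C_Suc by (simp add: walk_step_def)
  also have "\<dots> = (\<integral>\<^sup>+ \<omega>. F (\<lambda>_. y) \<partial>IT.C 0 0 (\<lambda>_. undefined))"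
    by (intro nn_integral_cong determinedD[OF F]) simp
  also have "\<dots> = F (\<lambda>_. y)"
    by (simp add: prob_space.emeasure_space_1[OF IT.prob_space_C] del: IT.C.simps)
  finally show ?thesis .
qed

text \<open>The Markov property: the last coordinate is integrated out first, and given the past it
  is uniform on the neighbours of the current vertex.\<close>

lemma nn_integral_walk_Suc:
  fixes F :: "(nat \<Rightarrow> 'a) \<Rightarrow> ennreal"
  assumes F: "determined (Suc (Suc t)) F"
  shows "(\<integral>\<^sup>+ \<omega>. F \<omega> \<partial>walk_measure G y) =
    (\<integral>\<^sup>+ \<omega>. (\<integral>\<^sup>+ v. F (fun_upd \<omega> (Suc t) v) \<partial>measure_pmf (pmf_of_set (nbrs G (\<omega> t)))) \<partial>walk_measure G y)"
proof -
  \<comment> \<open>The inner integral no longer reads coordinate \<open>Suc t\<close>, so it can be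
    moved back from the kernel composition to the walk measure.\<close>
  have *: "determined (Suc t) (\<lambda>\<omega>. \<integral>\<^sup>+ v. F (fun_upd \<omega> (Suc t) v) \<partial>measure_pmf (pmf_of_set (nbrs G (\<omega> t))))"
    unfolding determined_def
  proof (intro allI impI)
    fix \<omega> \<omega>' :: "nat \<Rightarrow> 'a" assume eq: "\<forall>i<Suc t. \<omega> i = \<omega>' i"
    then have "F (fun_upd \<omega> (Suc t) v) = F (fun_upd \<omega>' (Suc t) v)" for v
      by (intro determinedD[OF F]) (auto simp: less_Suc_eq)
    with eq show "(\<integral>\<^sup>+ v. F (fun_upd \<omega> (Suc t) v) \<partial>measure_pmf (pmf_of_set (nbrs G (\<omega> t)))) =
      (\<integral>\<^sup>+ v. F (fun_upd \<omega>' (Suc t) v) \<partial>measure_pmf (pmf_of_set (nbrs G (\<omega>' t))))" by simp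
  qed
  show ?thesis
    unfolding nn_integral_walk_C[OF F] nn_integral_walk_C[OF *] nn_integral_C_Suc
    by (simp add: walk_step_def)
qed

lemma prob_space_walk_measure: "prob_space (walk_measure G y)"
proof
  show "emeasure (walk_measure G y) (space (walk_measure G y)) = 1"
    using nn_integral_walk_0[of "\<lambda>_. 1"] by (simp add: determined_def)
qed

lemma AE_walk_0: "AE \<omega> in walk_measure G y. \<omega> 0 = y"
proof -
  let ?F = "\<lambda>\<omega> :: nat \<Rightarrow> 'a. if \<omega> 0 = y then 0 else 1 :: ennreal"
  have d: "determined (Suc 0) ?F" unfolding determined_def by auto
  then have "?F \<in> borel_measurable (walk_measure G y)" by (rule measurable_determined) simp
  moreover have "(\<integral>\<^sup>+ \<omega>. ?F \<omega> \<partial>walk_measure G y) = 0"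
    using nn_integral_walk_0[OF d] by simp
  ultimately have "AE \<omega> in walk_measure G y. ?F \<omega> = 0"
    by (simp only: nn_integral_0_iff_AE)
  then show ?thesis
    by (rule eventually_mono) (auto split: if_splits)
qed

lemma AE_walk:
  assumes "y \<in> verts G" and nb: "\<And>v. v \<in> verts G \<Longrightarrow> finite (nbrs G v) \<and> nbrs G v \<noteq> {}"
  shows "AE \<omega> in walk_measure G y. \<omega> 0 = y \<and> (\<forall>t. \<omega> t \<in> verts G \<and> \<omega> (Suc t) \<in> nbrs G (\<omega> t))"
proof -
  \<comment> \<open>A single step gives only this implication, because the uniform law is controlled
    only at vertices of \<open>G\<close>. Once it holds for all \<open>t\<close> at once, induction
    along the path discharges the premise.\<close>
  have *: "AE \<omega> in walk_measure G y. \<omega> t \<in> verts G \<longrightarrow> \<omega> (Suc t) \<in> nbrs G (\<omega> t)" for t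
  proof -
    let ?F = "\<lambda>\<omega>. if \<omega> t \<in> verts G \<longrightarrow> \<omega> (Suc t) \<in> nbrs G (\<omega> t) then 0 else 1 :: ennreal"
    have d: "determined (Suc (Suc t)) ?F" unfolding determined_def by auto
    have 0: "(\<integral>\<^sup>+ v. ?F (fun_upd \<omega> (Suc t) v) \<partial>measure_pmf (pmf_of_set (nbrs G (\<omega> t)))) = 0" for \<omega>
      by (subst nn_integral_0_iff_AE)
         (use nb in \<open>auto simp: AE_measure_pmf_iff\<close>)
    from d have "?F \<in> borel_measurable (walk_measure G y)" by (rule measurable_determined) simp
    moreover have "(\<integral>\<^sup>+ \<omega>. ?F \<omega> \<partial>walk_measure G y) = 0"
      unfolding nn_integral_walk_Suc[OF d] 0 by simp
    ultimately have "AE \<omega> in walk_measure G y. ?F \<omega> = 0"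
      by (simp only: nn_integral_0_iff_AE)
    then show ?thesis
      by (rule eventually_mono) (simp split: if_splits)
  qed
  have "AE \<omega> in walk_measure G y. \<omega> 0 = y \<and> (\<forall>t. \<omega> t \<in> verts G \<longrightarrow> \<omega> (Suc t) \<in> nbrs G (\<omega> t))"
    using AE_walk_0 * by (auto simp: AE_all_countable)
  then show ?thesis
  proof (rule eventually_mono)
    fix \<omega> assume h: "\<omega> 0 = y \<and> (\<forall>t. \<omega> t \<in> verts G \<longrightarrow> \<omega> (Suc t) \<in> nbrs G (\<omega> t))"
    have "\<omega> t \<in> verts G" for t
      by (induction t) (use h assms(1) in \<open>auto simp: nbrs_def\<close>)
    with h show "\<omega> 0 = y \<and> (\<forall>t. \<omega> t \<in> verts G \<and> \<omega> (Suc t) \<in> nbrs G (\<omega> t))" by simp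
  qed
qed

end

section \<open>The cycle\<close>

lemma verts_cycle_graph [simp]: "verts (cycle_graph n) = {0..<n}"
  by (simp add: cycle_graph_def)

lemma nbrs_cycle_graph:
  assumes "u < n"
  shows "nbrs (cycle_graph n) u = {Suc u mod n, (u + n - 1) mod n}"
proof -
  have 1: "u = Suc i mod n \<longleftrightarrow> i = (u + n - 1) mod n" if "i < n" for i
  proof (cases "Suc i = n")
    case True
    then show ?thesis using assms by (cases u) auto
  next
    case False
    with that have "Suc i mod n = Suc i" by simp
    then show ?thesis using assms that by (cases u) auto
  qed
  have "v \<in> nbrs (cycle_graph n) u \<longleftrightarrow> v = Suc u mod n \<or> v = (u + n - 1) mod n" for v
    using assms 1[of v] unfolding nbrs_def cycle_graph_def by (auto simp: doubleton_eq_iff)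
  then show ?thesis by blast
qed

text \<open>The lift of an edge to the integers. Everything but the successor counts as a backward
  step, so the value is a sign for arbitrary arguments; between neighbours with
  \<open>n \<ge> 3\<close> it identifies the direction taken.\<close>

definition increment :: "nat \<Rightarrow> nat \<Rightarrow> nat \<Rightarrow> int" where
  "increment n u v = (if v = Suc u mod n then 1 else -1)"

lemma abs_increment [simp]: "\<bar>increment n u v\<bar> = 1"
  by (simp add: increment_def)

lemma abs_real_increment [simp]: "\<bar>real_of_int (increment n u v)\<bar> = 1"
  by (simp add: increment_def)

lemma int_mod_pred: "u < n \<Longrightarrow> int ((u + n - 1) mod n) = (int u - 1) mod int n"
proof -
  assume "u < n"
  then have "int ((u + n - 1) mod n) = ((int u - 1) + int n) mod int n"
    by (simp add: zmod_int of_nat_diff algebra_simps)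
  then show ?thesis by (simp only: mod_add_self2)
qed

lemma nbr_increment_cong:
  assumes "u < n" "v \<in> nbrs (cycle_graph n) u"
  shows "[int v = int u + increment n u v] (mod int n)"
proof (cases "v = Suc u mod n")
  case True
  then show ?thesis by (simp add: increment_def zmod_int cong_def add.commute)
next
  case False
  with assms have "v = (u + n - 1) mod n" by (simp add: nbrs_cycle_graph)
  with False show ?thesis using int_mod_pred[OF assms(1)] by (simp add: increment_def cong_def)
qed

lemma closed_nbrs_cycle_graph_cong:
  assumes "u < n" "v \<in> closed_nbrs (cycle_graph n) u"
  obtains e where "\<bar>e\<bar> \<le> 1" "[int v = int u + e] (mod int n)"
  using assms that[of 0] nbr_increment_cong[of u n v] that[of "increment n u v"]
  unfolding closed_nbrs_def by auto

lemma closed_nbrs_cycle_graphI: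
  assumes "u < n" "v < n" "\<bar>e\<bar> \<le> 1" "[int v = int u + e] (mod int n)"
  shows "v \<in> closed_nbrs (cycle_graph n) u"
proof -
  have v: "int v = (int u + e) mod int n" using assms(2,4) by (simp add: cong_def)
  consider "e = 0" | "e = 1" | "e = -1" using assms(3) by linarith
  then show ?thesis
  proof cases
    case 1 then show ?thesis using v assms(1) by (simp add: closed_nbrs_def)
  next
    case 2
    then have "int v = int (Suc u mod n)" using v by (simp add: zmod_int add.commute)
    then show ?thesis using assms(1) by (simp add: closed_nbrs_def nbrs_cycle_graph)
  next
    case 3
    then have "int v = int ((u + n - 1) mod n)" using v int_mod_pred[OF assms(1)] by simp
    then show ?thesis using assms(1) by (simp add: closed_nbrs_def nbrs_cycle_graph)
  qed
qed

lemma finite_nonempty_nbrs_cycle_graph: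
  "v \<in> verts (cycle_graph n) \<Longrightarrow> finite (nbrs (cycle_graph n) v) \<and> nbrs (cycle_graph n) v \<noteq> {}"
  by (simp add: nbrs_cycle_graph)

lemma two_nbrs_cycle_graph: "n \<ge> 3 \<Longrightarrow> u < n \<Longrightarrow> Suc u mod n \<noteq> (u + n - 1) mod n"
  by (cases u; cases "Suc u = n") auto

section \<open>The increments as fair coin flips\<close>

text \<open>The two neighbours are distinct, so each direction has probability one half, while
  \<open>F\<close> is already fixed before the step is taken.\<close>

lemma nn_integral_walk_increment:
  fixes F :: "(nat \<Rightarrow> nat) \<Rightarrow> ennreal"
  assumes n: "n \<ge> 3" "y < n" and F: "determined (Suc t) F" and e: "e \<in> {1, -1}"
  shows "(\<integral>\<^sup>+ \<omega>. F \<omega> * indicator {\<omega>. increment n (\<omega> t) (\<omega> (Suc t)) = e} \<omega> \<partial>walk_measure (cycle_graph n) y) =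
    (\<integral>\<^sup>+ \<omega>. F \<omega> / 2 \<partial>walk_measure (cycle_graph n) y)"
proof -
  have d: "determined (Suc (Suc t)) (\<lambda>\<omega>. F \<omega> * indicator {\<omega>. increment n (\<omega> t) (\<omega> (Suc t)) = e} \<omega>)"
    by (intro determined_times determined_mono[OF F]) (auto simp: determined_def indicator_def)
  show ?thesis
    unfolding nn_integral_walk_Suc[OF d]
  proof (rule nn_integral_cong_AE, rule AE_mp[OF AE_walk AE_I2])
    show "y \<in> verts (cycle_graph n)" using n by simp
    fix \<omega> :: "nat \<Rightarrow> nat"
    show "\<omega> 0 = y \<and> (\<forall>t. \<omega> t \<in> verts (cycle_graph n) \<and> \<omega> (Suc t) \<in> nbrs (cycle_graph n) (\<omega> t)) \<longrightarrow>
      (\<integral>\<^sup>+ v. F (fun_upd \<omega> (Suc t) v) * indicator {\<omega>. increment n (\<omega> t) (\<omega> (Suc t)) = e} (fun_upd \<omega> (Suc t) v)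
        \<partial>measure_pmf (pmf_of_set (nbrs (cycle_graph n) (\<omega> t)))) = F \<omega> / 2"
    proof
      assume "\<omega> 0 = y \<and> (\<forall>t. \<omega> t \<in> verts (cycle_graph n) \<and> \<omega> (Suc t) \<in> nbrs (cycle_graph n) (\<omega> t))"
      then have u: "\<omega> t < n" by simp
      have "F (fun_upd \<omega> (Suc t) v) = F \<omega>" for v
        by (rule determinedD[OF F]) simp
      then show "(\<integral>\<^sup>+ v. F (fun_upd \<omega> (Suc t) v) * indicator {\<omega>. increment n (\<omega> t) (\<omega> (Suc t)) = e} (fun_upd \<omega> (Suc t) v)
        \<partial>measure_pmf (pmf_of_set (nbrs (cycle_graph n) (\<omega> t)))) = F \<omega> / 2"
        using two_nbrs_cycle_graph[OF n(1) u] e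
        by (subst nn_integral_pmf_of_set)
          (auto simp: nbrs_cycle_graph[OF u] increment_def indicator_def)
    qed
  qed (rule finite_nonempty_nbrs_cycle_graph)
qed

lemma integrable_determined:
  fixes F :: "(nat \<Rightarrow> 'a :: countable) \<Rightarrow> real"
  assumes "determined m F" "\<And>\<omega>. \<bar>F \<omega>\<bar> \<le> B"
  shows "integrable (walk_measure G y) F"
proof -
  interpret prob_space "walk_measure G y" by (rule prob_space_walk_measure)
  show ?thesis
    by (rule integrable_const_bound[of _ B]) (use assms measurable_determined[OF assms(1)] in auto)
qed

lemma determined_increment:
  "s < t \<Longrightarrow> determined (Suc t) (\<lambda>\<omega>. increment n (\<omega> s) (\<omega> (Suc s)))"
  by (simp add: determined_def)

lemma integrable_times_increment:
  fixes F :: "(nat \<Rightarrow> nat) \<Rightarrow> real"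
  assumes F: "determined (Suc t) F" and B: "\<And>\<omega>. \<bar>F \<omega>\<bar> \<le> B"
  shows "integrable (walk_measure G y) (\<lambda>\<omega>. F \<omega> * increment n (\<omega> t) (\<omega> (Suc t)))"
proof (rule integrable_determined)
  show "determined (Suc (Suc t)) (\<lambda>\<omega>. F \<omega> * increment n (\<omega> t) (\<omega> (Suc t)))"
    by (intro determined_times determined_mono[OF F] determined_comp[OF determined_increment]) simp_all
  show "\<bar>F \<omega> * increment n (\<omega> t) (\<omega> (Suc t))\<bar> \<le> B" for \<omega>
    using B[of \<omega>] by (simp add: abs_mult)
qed

text \<open>The martingale property: given the past, the next increment has mean zero. For
  nonnegative weights both signs carry equal mass; a bounded signed weight is reduced to this case
  by a shift.\<close>

lemma integral_walk_increment:
  fixes F :: "(nat \<Rightarrow> nat) \<Rightarrow> real"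
  assumes n: "n \<ge> 3" "y < n" and F: "determined (Suc t) F" and B: "\<And>\<omega>. \<bar>F \<omega>\<bar> \<le> B"
  shows "(\<integral> \<omega>. F \<omega> * increment n (\<omega> t) (\<omega> (Suc t)) \<partial>walk_measure (cycle_graph n) y) = 0"
proof -
  let ?M = "walk_measure (cycle_graph n) y"
  let ?I = "\<lambda>e. {\<omega>. increment n (\<omega> t) (\<omega> (Suc t)) = e}"
  have dI: "determined (Suc (Suc t)) (indicator (?I e) :: _ \<Rightarrow> real)" for e
    by (auto simp: determined_def indicator_def)
  have pos: "(\<integral> \<omega>. H \<omega> * indicator (?I 1) \<omega> \<partial>?M) = (\<integral> \<omega>. H \<omega> * indicator (?I (-1)) \<omega> \<partial>?M)"
    if H: "determined (Suc t) H" "\<And>\<omega>. 0 \<le> H \<omega>" for H :: "(nat \<Rightarrow> nat) \<Rightarrow> real"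
  proof -
    have "(\<integral> \<omega>. H \<omega> * indicator (?I e) \<omega> \<partial>?M) = enn2real (\<integral>\<^sup>+ \<omega>. ennreal (H \<omega>) / 2 \<partial>?M)"
      if "e \<in> {1, -1}" for e
    proof -
      have "determined (Suc (Suc t)) (\<lambda>\<omega>. H \<omega> * indicator (?I e) \<omega>)"
        by (intro determined_times determined_mono[OF H(1)] dI) simp
      then have "(\<lambda>\<omega>. H \<omega> * indicator (?I e) \<omega>) \<in> borel_measurable ?M"
        by (rule measurable_determined) simp
      then have "(\<integral> \<omega>. H \<omega> * indicator (?I e) \<omega> \<partial>?M) =
        enn2real (\<integral>\<^sup>+ \<omega>. ennreal (H \<omega> * indicator (?I e) \<omega>) \<partial>?M)"
        by (intro integral_eq_nn_integral) (auto simp: H)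
      also have "(\<integral>\<^sup>+ \<omega>. ennreal (H \<omega> * indicator (?I e) \<omega>) \<partial>?M) =
        (\<integral>\<^sup>+ \<omega>. ennreal (H \<omega>) * indicator (?I e) \<omega> \<partial>?M)"
        by (intro nn_integral_cong) (auto split: split_indicator)
      also have "\<dots> = (\<integral>\<^sup>+ \<omega>. ennreal (H \<omega>) / 2 \<partial>?M)"
        using that by (intro nn_integral_walk_increment n determined_comp[OF H(1)])
      finally show ?thesis .
    qed
    from this[of 1] this[of "-1"] show ?thesis by simp
  qed
  have int: "integrable ?M (\<lambda>\<omega>. H \<omega> * indicator (?I e) \<omega>)"
    if "determined (Suc t) H" "\<And>\<omega>. \<bar>H \<omega>\<bar> \<le> C" for H :: "(nat \<Rightarrow> nat) \<Rightarrow> real" and C e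
  proof (rule integrable_determined)
    show "determined (Suc (Suc t)) (\<lambda>\<omega>. H \<omega> * indicator (?I e) \<omega>)"
      by (intro determined_times determined_mono[OF that(1)] dI) simp
    show "\<bar>H \<omega> * indicator (?I e) \<omega>\<bar> \<le> max C 0" for \<omega>
      using that(2)[of \<omega>] by (auto split: split_indicator)
  qed
  \<comment> \<open>The weights \<open>F + B\<close> and \<open>B\<close> are both nonnegative, and
    \<open>F\<close> is their difference.\<close>
  have "B \<ge> 0" using B[of undefined] by linarith
  have c: "determined (Suc t) (\<lambda>\<omega> :: nat \<Rightarrow> nat. B)" by (simp add: determined_def)
  have FB: "determined (Suc t) (\<lambda>\<omega>. F \<omega> + B)" by (rule determined_comp[OF F])
  have FB0: "0 \<le> F \<omega> + B" for \<omega> using B[of \<omega>] by linarith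
  have split: "(\<integral> \<omega>. (F \<omega> + B) * indicator (?I e) \<omega> \<partial>?M) =
     (\<integral> \<omega>. F \<omega> * indicator (?I e) \<omega> \<partial>?M) + (\<integral> \<omega>. B * indicator (?I e) \<omega> \<partial>?M)" for e
    unfolding distrib_right using int[OF F B] int[OF c] by (subst Bochner_Integration.integral_add) auto
  have "(\<integral> \<omega>. F \<omega> * increment n (\<omega> t) (\<omega> (Suc t)) \<partial>?M) =
     (\<integral> \<omega>. F \<omega> * indicator (?I 1) \<omega> - F \<omega> * indicator (?I (-1)) \<omega> \<partial>?M)"
    by (intro Bochner_Integration.integral_cong) (auto simp: increment_def indicator_def)
  also have "\<dots> = (\<integral> \<omega>. F \<omega> * indicator (?I 1) \<omega> \<partial>?M) - (\<integral> \<omega>. F \<omega> * indicator (?I (-1)) \<omega> \<partial>?M)"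
    using int[OF F B] by (subst Bochner_Integration.integral_diff) auto
  also have "\<dots> = 0"
    using pos[OF FB FB0] pos[OF c \<open>B \<ge> 0\<close>] unfolding split by linarith
  finally show ?thesis .
qed

section \<open>Plays\<close>

text \<open>The event that the capture time exceeds \<open>t\<close>. The quantifier over earlier
  rounds matters: plays continue after a capture, so \<open>caught\<close> is not monotone in
  time.\<close>

definition uncaught :: "'a cop_strategy \<Rightarrow> 'a robber_strategy \<Rightarrow> 'a list \<Rightarrow> 'a \<Rightarrow> nat \<Rightarrow> bool" where
  "uncaught \<sigma> \<rho> x y t \<longleftrightarrow> (\<forall>s\<le>t. \<not> caught \<sigma> \<rho> x y s)"

lemma uncaught_Suc: "uncaught \<sigma> \<rho> x y (Suc t) \<longleftrightarrow> uncaught \<sigma> \<rho> x y t \<and> \<not> caught \<sigma> \<rho> x y (Suc t)"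
  by (auto simp: uncaught_def le_Suc_eq)

lemma uncaught_imp_notin:
  "uncaught \<sigma> \<rho> x y t \<Longrightarrow> robber_at \<sigma> \<rho> x y t \<notin> set (cops_at \<sigma> \<rho> x y t)"
  by (auto simp: uncaught_def caught_def)

lemma uncaught_Suc_imp_notin:
  "uncaught \<sigma> \<rho> x y (Suc t) \<Longrightarrow> robber_at \<sigma> \<rho> x y t \<notin> set (cops_at \<sigma> \<rho> x y (Suc t))"
  by (auto simp: uncaught_def caught_def)

lemma length_play [simp]: "length (play \<sigma> \<rho> x y t) = Suc t"
  by (induction t) (simp_all add: Let_def)

lemma play_nonempty [simp]: "play \<sigma> \<rho> x y t \<noteq> []"
  by (metis length_play length_0_conv nat.distinct(1))

lemma hd_play [simp]: "hd (play \<sigma> \<rho> x y t) = (x, y)"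
  by (induction t) (simp_all add: Let_def)

lemma cops_at_0 [simp]: "cops_at \<sigma> \<rho> x y 0 = x"
  by (simp add: cops_at_def)

lemma robber_at_0 [simp]: "robber_at \<sigma> \<rho> x y 0 = y"
  by (simp add: robber_at_def)

lemma cops_at_Suc: "cops_at \<sigma> \<rho> x y (Suc t) = \<sigma> (play \<sigma> \<rho> x y t)"
  by (simp add: cops_at_def Let_def)

lemma robber_at_Suc:
  "robber_at \<sigma> \<rho> x y (Suc t) = \<rho> (play \<sigma> \<rho> x y t) (cops_at \<sigma> \<rho> x y (Suc t))"
  by (simp add: robber_at_def cops_at_Suc Let_def)

lemma last_play: "last (play \<sigma> \<rho> x y t) = (cops_at \<sigma> \<rho> x y t, robber_at \<sigma> \<rho> x y t)"
  by (simp add: cops_at_def robber_at_def)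

lemma play_snoc:
  "play \<sigma> \<rho> x y t = butlast (play \<sigma> \<rho> x y t) @ [(cops_at \<sigma> \<rho> x y t, robber_at \<sigma> \<rho> x y t)]"
  by (metis append_butlast_last_id play_nonempty last_play)

text \<open>The history before round \<open>t\<close> has length \<open>t\<close>, which makes
  \<open>drunk\<close> play \<open>\<omega> t\<close>. Round 0 is not governed by the strategy,
  hence the start at \<open>\<omega> 0\<close>.\<close>

lemma robber_at_drunk: "robber_at \<sigma> (drunk \<omega>) x (\<omega> 0) t = \<omega> t"
  by (cases t) (simp_all add: robber_at_Suc drunk_def)

lemma cops_move:
  assumes "\<sigma> \<in> cop_strategies G" "set (cops_at \<sigma> \<rho> x y t) \<subseteq> verts G" "robber_at \<sigma> \<rho> x y t \<in> verts G"
  shows "list_all2 (\<lambda>u u'. u' \<in> closed_nbrs G u) (cops_at \<sigma> \<rho> x y t) (cops_at \<sigma> \<rho> x y (Suc t))"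
proof -
  have "list_all2 (\<lambda>u u'. u' \<in> closed_nbrs G u) x' (\<sigma> (h @ [(x', y')]))"
    if "set x' \<subseteq> verts G" "y' \<in> verts G" for h x' y'
    using assms(1) that by (simp add: cop_strategies_def)
  from this[OF assms(2,3), of "butlast (play \<sigma> \<rho> x y t)"] show ?thesis
    by (simp only: cops_at_Suc play_snoc[symmetric])
qed

lemma closed_nbrs_subset_verts: "v \<in> verts G \<Longrightarrow> closed_nbrs G v \<subseteq> verts G"
  by (auto simp: closed_nbrs_def nbrs_def)

lemma cops_move_verts:
  assumes "\<sigma> \<in> cop_strategies G" "set (cops_at \<sigma> \<rho> x y t) \<subseteq> verts G" "robber_at \<sigma> \<rho> x y t \<in> verts G"
  shows "length (cops_at \<sigma> \<rho> x y (Suc t)) = length (cops_at \<sigma> \<rho> x y t)"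
    and "set (cops_at \<sigma> \<rho> x y (Suc t)) \<subseteq> verts G"
proof -
  note m = cops_move[OF assms]
  show l: "length (cops_at \<sigma> \<rho> x y (Suc t)) = length (cops_at \<sigma> \<rho> x y t)"
    using list_all2_lengthD[OF m] by simp
  have "cops_at \<sigma> \<rho> x y (Suc t) ! i \<in> verts G" if "i < length (cops_at \<sigma> \<rho> x y (Suc t))" for i
  proof -
    have "cops_at \<sigma> \<rho> x y t ! i \<in> verts G" by (rule subsetD[OF assms(2) nth_mem]) (use that l in simp)
    from subsetD[OF closed_nbrs_subset_verts[OF this] list_all2_nthD2[OF m that]] show ?thesis .
  qed
  then show "set (cops_at \<sigma> \<rho> x y (Suc t)) \<subseteq> verts G" by (auto simp: in_set_conv_nth)
qed

lemma cops_at_verts: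
  assumes "\<sigma> \<in> cop_strategies G" "set x \<subseteq> verts G" "\<And>t. robber_at \<sigma> \<rho> x y t \<in> verts G"
  shows "length (cops_at \<sigma> \<rho> x y t) = length x \<and> set (cops_at \<sigma> \<rho> x y t) \<subseteq> verts G"
  by (induction t) (use assms cops_move_verts[OF assms(1) _ assms(3)] in simp_all)

lemma robber_move:
  assumes "\<sigma> \<in> cop_strategies G" "\<rho> \<in> robber_strategies G"
    "set (cops_at \<sigma> \<rho> x y t) \<subseteq> verts G" "robber_at \<sigma> \<rho> x y t \<in> verts G"
  shows "robber_at \<sigma> \<rho> x y (Suc t) \<in> closed_nbrs G (robber_at \<sigma> \<rho> x y t)"
proof -
  have "\<rho> (h @ [(x', y')]) x'' \<in> closed_nbrs G y'"
    if "set x' \<subseteq> verts G" "y' \<in> verts G" "set x'' \<subseteq> verts G" for h x' y' x''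
    using assms(2) that by (simp add: robber_strategies_def)
  from this[OF assms(3,4) cops_move_verts(2)[OF assms(1,3,4)], of "butlast (play \<sigma> \<rho> x y t)"] show ?thesis
    by (simp only: robber_at_Suc play_snoc[symmetric])
qed

lemma play_verts:
  assumes "\<sigma> \<in> cop_strategies G" "\<rho> \<in> robber_strategies G" "set x \<subseteq> verts G" "y \<in> verts G"
  shows "set (cops_at \<sigma> \<rho> x y t) \<subseteq> verts G \<and> robber_at \<sigma> \<rho> x y t \<in> verts G"
proof (induction t)
  case (Suc t)
  then have c: "set (cops_at \<sigma> \<rho> x y t) \<subseteq> verts G" and r: "robber_at \<sigma> \<rho> x y t \<in> verts G"
    by simp_all
  show ?case
    using cops_move_verts(2)[OF assms(1) c r] robber_move[OF assms(1,2) c r]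
      closed_nbrs_subset_verts[OF r] by (simp add: subsetD)
qed (use assms in auto)

lemma capture_time_le: "caught \<sigma> \<rho> x y t \<Longrightarrow> capture_time \<sigma> \<rho> x y \<le> enat t"
  unfolding capture_time_def by (rule INF_lower) simp

lemma capture_time_infinity:
  assumes "\<And>t. uncaught \<sigma> \<rho> x y t"
  shows "capture_time \<sigma> \<rho> x y = \<infinity>"
proof -
  have "{t. caught \<sigma> \<rho> x y t} = {}" using assms unfolding uncaught_def by blast
  then show ?thesis unfolding capture_time_def by (simp only: image_empty Inf_empty top_enat_def)
qed

text \<open>The tail-sum formula, which turns the expected capture time into a sum of survival
  probabilities. If no capture occurs, all terms are 1 and both sides are infinite.\<close>

lemma capture_time_eq_suminf:
  "ennreal_of_enat (capture_time \<sigma> \<rho> x y) = (\<Sum>t. of_bool (uncaught \<sigma> \<rho> x y t))"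
proof (cases "\<exists>t. caught \<sigma> \<rho> x y t")
  case True
  define T where "T = (LEAST t. caught \<sigma> \<rho> x y t)"
  have T: "caught \<sigma> \<rho> x y T" "\<And>t. caught \<sigma> \<rho> x y t \<Longrightarrow> T \<le> t"
    using True unfolding T_def by (auto intro: LeastI Least_le)
  have "uncaught \<sigma> \<rho> x y t \<longleftrightarrow> t < T" for t
    unfolding uncaught_def using T(1) dual_order.trans[OF _ T(2)] by (auto simp: not_le[symmetric])
  then have "(\<Sum>t. of_bool (uncaught \<sigma> \<rho> x y t) :: ennreal) = (\<Sum>t<T. 1)"
    by (subst suminf_finite[of "{..<T}"]) auto
  moreover have "capture_time \<sigma> \<rho> x y = enat T"
    unfolding capture_time_def using T by (intro antisym INF_lower INF_greatest) auto
  ultimately show ?thesis by simp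
next
  case False
  then have u: "uncaught \<sigma> \<rho> x y t" for t by (simp add: uncaught_def)
  have "(\<Sum>t. of_bool (uncaught \<sigma> \<rho> x y t) :: ennreal) = (SUP n. of_nat n)"
    by (simp add: u suminf_eq_SUP)
  then show ?thesis using capture_time_infinity[OF u] by (simp add: ennreal_SUP_of_nat_eq_top)
qed

lemma determined_play: "determined (Suc t) (\<lambda>\<omega>. play \<sigma> (drunk \<omega>) x y t)"
proof (induction t)
  case (Suc t)
  show ?case
    unfolding determined_def
  proof (intro allI impI)
    fix \<omega> \<omega>' :: "nat \<Rightarrow> 'a" assume eq: "\<forall>i<Suc (Suc t). \<omega> i = \<omega>' i"
    then have "play \<sigma> (drunk \<omega>) x y t = play \<sigma> (drunk \<omega>') x y t"
      by (intro determinedD[OF Suc]) simp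
    with eq show "play \<sigma> (drunk \<omega>) x y (Suc t) = play \<sigma> (drunk \<omega>') x y (Suc t)"
      by (simp add: Let_def drunk_def)
  qed
qed (simp add: determined_def)

lemma determined_caught: "determined (Suc t) (\<lambda>\<omega>. caught \<sigma> (drunk \<omega>) x y t)"
proof -
  have d: "determined (Suc t) (\<lambda>\<omega>. play \<sigma> (drunk \<omega>) x y (t - 1))"
    by (rule determined_mono[OF determined_play]) simp
  show ?thesis
    unfolding determined_def
  proof (intro allI impI)
    fix \<omega> \<omega>' :: "nat \<Rightarrow> 'a" assume eq: "\<forall>i<Suc t. \<omega> i = \<omega>' i"
    have "play \<sigma> (drunk \<omega>) x y (t - 1) = play \<sigma> (drunk \<omega>') x y (t - 1)"
      using eq by (intro determinedD[OF d]) simp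
    moreover have "play \<sigma> (drunk \<omega>) x y t = play \<sigma> (drunk \<omega>') x y t"
      using eq by (intro determinedD[OF determined_play]) simp
    ultimately show "caught \<sigma> (drunk \<omega>) x y t = caught \<sigma> (drunk \<omega>') x y t"
      unfolding caught_def cops_at_def robber_at_def by simp
  qed
qed

lemma determined_uncaught: "determined (Suc t) (\<lambda>\<omega>. uncaught \<sigma> (drunk \<omega>) x y t)"
proof -
  have "determined (Suc t) (\<lambda>\<omega>. caught \<sigma> (drunk \<omega>) x y s)" if "s \<le> t" for s
    by (rule determined_mono[OF determined_caught]) (use that in simp)
  then show ?thesis unfolding determined_def uncaught_def by blast
qed

section \<open>The speed limit for cops in lifted coordinates\<close>

lemma cops_displacement:
  assumes "\<sigma> \<in> cop_strategies (cycle_graph n)" "set x \<subseteq> {0..<n}" "\<And>t. robber_at \<sigma> \<rho> x y t < n"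
    and i: "i < length x"
  obtains c where "\<bar>c\<bar> \<le> int t" "[int (cops_at \<sigma> \<rho> x y t ! i) = int (x ! i) + c] (mod int n)"
proof -
  note v = cops_at_verts[OF assms(1), of x \<rho> y]
  have v: "length (cops_at \<sigma> \<rho> x y t) = length x \<and> set (cops_at \<sigma> \<rho> x y t) \<subseteq> {0..<n}" for t
    using v assms(2,3) by simp
  have "\<exists>c. \<bar>c\<bar> \<le> int t \<and> [int (cops_at \<sigma> \<rho> x y t ! i) = int (x ! i) + c] (mod int n)"
  proof (induction t)
    case 0
    then show ?case by (intro exI[of _ 0]) simp
  next
    case (Suc t)
    then obtain c where c: "\<bar>c\<bar> \<le> int t" "[int (cops_at \<sigma> \<rho> x y t ! i) = int (x ! i) + c] (mod int n)"
      by blast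
    have m: "list_all2 (\<lambda>u u'. u' \<in> closed_nbrs (cycle_graph n) u) (cops_at \<sigma> \<rho> x y t) (cops_at \<sigma> \<rho> x y (Suc t))"
      using v[of t] assms(3) by (intro cops_move[OF assms(1)]) simp_all
    have cl: "cops_at \<sigma> \<rho> x y (Suc t) ! i \<in> closed_nbrs (cycle_graph n) (cops_at \<sigma> \<rho> x y t ! i)"
      using list_all2_nthD[OF m, of i] i v[of t] by simp
    have "cops_at \<sigma> \<rho> x y t ! i \<in> {0..<n}"
      using v[of t] i by (intro subsetD[OF conjunct2[OF v[of t]]] nth_mem) simp
    then have "cops_at \<sigma> \<rho> x y t ! i < n" by simp
    then obtain e where e: "\<bar>e\<bar> \<le> 1"
      "[int (cops_at \<sigma> \<rho> x y (Suc t) ! i) = int (cops_at \<sigma> \<rho> x y t ! i) + e] (mod int n)"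
      using closed_nbrs_cycle_graph_cong[OF _ cl] by blast
    have "[int (cops_at \<sigma> \<rho> x y (Suc t) ! i) = int (x ! i) + (c + e)] (mod int n)"
      using cong_trans[OF e(2) cong_add[OF c(2) cong_refl[of e]]] by (simp add: add.assoc)
    with c(1) e(1) show ?case by (intro exI[of _ "c + e"]) auto
  qed
  then show ?thesis using that by blast
qed

lemma nat_cong_imp_eq: "p < n \<Longrightarrow> q < n \<Longrightarrow> [int p = int q] (mod int n) \<Longrightarrow> p = q"
  by (simp add: cong_def)

text \<open>The integers serve as universal cover of the cycle, with \<open>k\<close> running over
  the lifts of a cop. An arc across vertex \<open>0\<close> thus becomes an ordinary interval, such
  as the one from \<open>v\<close> to \<open>u + n\<close>.\<close>

definition clear_arc :: "nat \<Rightarrow> nat list \<Rightarrow> int \<Rightarrow> int \<Rightarrow> bool" where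
  "clear_arc n x lo hi \<longleftrightarrow> (\<forall>p\<in>set x. \<forall>k. int p + k * int n \<le> lo \<or> hi \<le> int p + k * int n)"

lemma caught_imp_distance_le:
  assumes \<sigma>: "\<sigma> \<in> cop_strategies (cycle_graph n)" "set x \<subseteq> {0..<n}" "\<And>t. robber_at \<sigma> \<rho> x y t < n"
    and arc: "clear_arc n x lo hi"
    and R: "\<And>t. [R t = int (robber_at \<sigma> \<rho> x y t)] (mod int n)" "\<And>t. \<bar>R (Suc t) - R t\<bar> \<le> 1"
    and c: "caught \<sigma> \<rho> x y t"
  shows "min (R t - lo) (hi - R t) \<le> int t + 1"
proof -
  \<comment> \<open>Here \<open>s\<close> is \<open>t\<close>, or \<open>t - 1\<close> if a cop
    stepped onto the robber's previous vertex; this is the source of the \<open>+ 1\<close> in the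
    bound.\<close>
  have "\<exists>s. \<bar>R t - R s\<bar> \<le> 1 \<and> robber_at \<sigma> \<rho> x y s \<in> set (cops_at \<sigma> \<rho> x y t)"
  proof (cases "robber_at \<sigma> \<rho> x y t \<in> set (cops_at \<sigma> \<rho> x y t)")
    case False
    then show ?thesis using c R(2)[of "t - 1"] unfolding caught_def
      by (intro exI[of _ "t - 1"]) auto
  qed (auto intro!: exI[of _ t])
  then obtain s i where s: "\<bar>R t - R s\<bar> \<le> 1" "i < length (cops_at \<sigma> \<rho> x y t)"
    "cops_at \<sigma> \<rho> x y t ! i = robber_at \<sigma> \<rho> x y s"
    by (auto simp: in_set_conv_nth)
  have "length (cops_at \<sigma> \<rho> x y t) = length x"
    using cops_at_verts[OF \<sigma>(1), of x \<rho> y t] \<sigma>(2,3) by simp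
  with s(2) have i: "i < length x" by simp
  obtain d where d: "\<bar>d\<bar> \<le> int t" "[int (cops_at \<sigma> \<rho> x y t ! i) = int (x ! i) + d] (mod int n)"
    by (rule cops_displacement[OF \<sigma> i])
  have "[R s = int (x ! i) + d] (mod int n)"
    using cong_trans[OF R(1)[of s]] d(2) s(3) by simp
  then obtain k where k: "int (x ! i) + d = R s + int n * k"
    by (auto simp: cong_iff_lin)
  have "int (x ! i) + (- k) * int n = R s - d" using k by (simp add: algebra_simps)
  \<comment> \<open>\<open>R s - d\<close> is the lift from which the capturing cop started, so the
    clear arc excludes it from the interior.\<close>
  then have "R s - d \<le> lo \<or> hi \<le> R s - d"
    using bspec[OF arc[unfolded clear_arc_def] nth_mem[OF i], THEN spec, of "- k"] by simp
  with d(1) s(1) show ?thesis by auto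
qed

section \<open>Cop strategies given by integer displacements\<close>

definition cycle_strategy :: "nat \<Rightarrow> (nat history \<Rightarrow> nat \<Rightarrow> int) \<Rightarrow> nat cop_strategy" where
  "cycle_strategy n f h =
     map (\<lambda>i. nat ((int (fst (last h) ! i) + f h i) mod int n)) [0..<length (fst (last h))]"

lemma length_cycle_strategy [simp]: "length (cycle_strategy n f h) = length (fst (last h))"
  by (simp add: cycle_strategy_def)

lemma nth_cycle_strategy:
  "i < length (fst (last h)) \<Longrightarrow>
    cycle_strategy n f h ! i = nat ((int (fst (last h) ! i) + f h i) mod int n)"
  by (simp add: cycle_strategy_def)

lemma cycle_strategy_cop_strategies:
  assumes "\<And>h i. \<bar>f h i\<bar> \<le> 1"
  shows "cycle_strategy n f \<in> cop_strategies (cycle_graph n)"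
proof -
  have "nat ((int (x ! i) + e) mod int n) \<in> closed_nbrs (cycle_graph n) (x ! i)"
    if "set x \<subseteq> {0..<n}" "i < length x" "\<bar>e\<bar> \<le> 1" for x :: "nat list" and i e
  proof -
    have "x ! i \<in> {0..<n}" by (rule subsetD[OF that(1) nth_mem[OF that(2)]])
    then have "x ! i < n" by simp
    moreover from this have "(int (x ! i) + e) mod int n \<ge> 0" "(int (x ! i) + e) mod int n < int n"
      by simp_all
    ultimately show ?thesis using that(3)
      by (intro closed_nbrs_cycle_graphI[of _ _ _ e]) (auto simp: cong_def nat_less_iff)
  qed
  then show ?thesis
    using assms by (auto simp: cop_strategies_def cycle_strategy_def list_all2_conv_all_nth)
qed

lemma cops_at_cycle_strategy:
  assumes f: "\<And>t. f (play (cycle_strategy n f) \<rho> x y t) i = c" and i: "i < length x" and n: "n > 0"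
  shows "length (cops_at (cycle_strategy n f) \<rho> x y t) = length x \<and>
    [int (cops_at (cycle_strategy n f) \<rho> x y t ! i) = int (x ! i) + int t * c] (mod int n)"
proof (induction t)
  case (Suc t)
  let ?p = "cops_at (cycle_strategy n f) \<rho> x y"
  have "[int (?p (Suc t) ! i) = int (?p t ! i) + c] (mod int n)"
    using Suc i n by (simp add: cops_at_Suc nth_cycle_strategy last_play f cong_def)
  with Suc have "[int (?p (Suc t) ! i) = int (x ! i) + int t * c + c] (mod int n)"
    by (meson cong_add cong_refl cong_trans)
  then show ?case
    using Suc by (simp add: cops_at_Suc last_play algebra_simps)
qed simp

section \<open>The drunk robber on the cycle\<close>

text \<open>The displacement in the universal cover, written \<open>W\<close> in the outline of the
  proof; it keeps the winding that \<open>\<omega> t\<close> forgets.\<close>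

definition lift :: "nat \<Rightarrow> (nat \<Rightarrow> nat) \<Rightarrow> nat \<Rightarrow> int" where
  "lift n \<omega> t = (\<Sum>s<t. increment n (\<omega> s) (\<omega> (Suc s)))"

lemma lift_0 [simp]: "lift n \<omega> 0 = 0"
  by (simp add: lift_def)

lemma lift_Suc: "lift n \<omega> (Suc t) = lift n \<omega> t + increment n (\<omega> t) (\<omega> (Suc t))"
  by (simp add: lift_def)

lemma lift_cong:
  assumes "\<And>t. \<omega> t < n \<and> \<omega> (Suc t) \<in> nbrs (cycle_graph n) (\<omega> t)"
  shows "[int (\<omega> t) = int (\<omega> 0) + lift n \<omega> t] (mod int n)"
proof (induction t)
  case (Suc t)
  have "[int (\<omega> (Suc t)) = int (\<omega> t) + increment n (\<omega> t) (\<omega> (Suc t))] (mod int n)"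
    using assms[of t] by (intro nbr_increment_cong) auto
  also have "[int (\<omega> t) + increment n (\<omega> t) (\<omega> (Suc t)) =
      int (\<omega> 0) + lift n \<omega> t + increment n (\<omega> t) (\<omega> (Suc t))] (mod int n)"
    by (rule cong_add[OF Suc cong_refl])
  finally show ?case by (simp add: lift_Suc add.assoc)
qed simp

lemma determined_lift: "determined (Suc t) (\<lambda>\<omega>. lift n \<omega> t)"
  unfolding determined_def lift_def by (intro allI impI sum.cong) simp_all

lemma abs_lift_le: "\<bar>lift n \<omega> t\<bar> \<le> int t"
  using sum_abs[of "\<lambda>s. increment n (\<omega> s) (\<omega> (Suc s))" "{..<t}"] by (simp add: lift_def)

text \<open>A cop walking in direction \<open>e\<close> captures from distance \<open>1\<close> by his next move, so the chase
  goes on only from distance at least \<open>2\<close>.\<close>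

fun chasing :: "nat \<Rightarrow> int \<Rightarrow> int \<Rightarrow> (nat \<Rightarrow> nat) \<Rightarrow> nat \<Rightarrow> bool" where
  "chasing n d e \<omega> 0 \<longleftrightarrow> d \<ge> 1"
| "chasing n d e \<omega> (Suc t) \<longleftrightarrow> chasing n d e \<omega> t \<and> d + e * lift n \<omega> t - int t \<ge> 2 \<and>
     d + e * lift n \<omega> (Suc t) - int (Suc t) \<ge> 1"

lemma chasing_ge_1: "chasing n d e \<omega> t \<Longrightarrow> d + e * lift n \<omega> t - int t \<ge> 1"
  by (cases t) auto

lemma determined_chasing: "determined (Suc t) (\<lambda>\<omega>. chasing n d e \<omega> t)"
proof (induction t)
  case (Suc t)
  show ?case
    unfolding determined_def
  proof (intro allI impI)
    fix \<omega> \<omega>' :: "nat \<Rightarrow> nat" assume eq: "\<forall>i<Suc (Suc t). \<omega> i = \<omega>' i"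
    have "chasing n d e \<omega> t = chasing n d e \<omega>' t"
      using eq by (intro determinedD[OF Suc]) simp
    moreover have "lift n \<omega> t = lift n \<omega>' t"
      using eq by (intro determinedD[OF determined_lift]) simp
    moreover have "lift n \<omega> (Suc t) = lift n \<omega>' (Suc t)"
      using eq by (intro determinedD[OF determined_lift]) simp
    ultimately show "chasing n d e \<omega> (Suc t) = chasing n d e \<omega>' (Suc t)" by simp
  qed
qed (simp add: determined_def)

section \<open>Upper bound for a fixed initial vertex\<close>

text \<open>Cop \<open>i\<close> walks steadily in direction \<open>e\<close>, so his gap to the
  robber at time \<open>t\<close> is \<open>d + e * lift n \<omega> t - int t\<close>. Only this
  implication is claimed, as the robber may run into another cop before the chase is over.\<close>

lemma uncaught_imp_chasing:
  assumes \<omega>: "\<And>t. \<omega> t < n \<and> \<omega> (Suc t) \<in> nbrs (cycle_graph n) (\<omega> t)"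
    and i: "i < length x" and e: "e \<in> {1, -1}"
    and y: "[int (\<omega> 0) = int (x ! i) + e * d] (mod int n)" and d: "d \<ge> 0"
    and \<sigma>: "\<sigma> = cycle_strategy n (\<lambda>h j. if j = i then e else 0)"
    and u: "uncaught \<sigma> (drunk \<omega>) x (\<omega> 0) t"
    and x: "set x \<subseteq> {0..<n}"
  shows "chasing n d e \<omega> t"
proof -
  have \<sigma>': "\<sigma> \<in> cop_strategies (cycle_graph n)"
    unfolding \<sigma> by (rule cycle_strategy_cop_strategies) (use e in auto)
  have n: "n > 0" using \<omega>[of 0] by simp
  let ?c = "cops_at \<sigma> (drunk \<omega>) x (\<omega> 0)"
  have c: "length (?c t) = length x \<and> [int (?c t ! i) = int (x ! i) + int t * e] (mod int n)" for t
    unfolding \<sigma> by (rule cops_at_cycle_strategy) (use i n in auto)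
  have cn: "?c t ! i < n" for t
  proof -
    have "set (?c t) \<subseteq> {0..<n}"
      using cops_at_verts[OF \<sigma>', of x "drunk \<omega>" "\<omega> 0" t] x \<omega> by (simp add: robber_at_drunk)
    moreover have "?c t ! i \<in> set (?c t)" using c i by simp
    ultimately show ?thesis by auto
  qed
  have ci: "?c t ! i \<in> set (?c t)" for t
    using c i by simp
  \<comment> \<open>Equal lifts mean equal vertices. It is applied with both times equal, and with
    the robber one round behind, for a cop who moves onto him.\<close>
  have eq: "\<omega> s \<in> set (?c t)" if "int (x ! i) + int t * e = int (x ! i) + e * d + lift n \<omega> s" for s t
  proof -
    have "[int (?c t ! i) = int (x ! i) + int t * e] (mod int n)" using c by blast
    also have "int (x ! i) + int t * e = (int (x ! i) + e * d) + lift n \<omega> s" by (rule that)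
    also have "[int (x ! i) + e * d + lift n \<omega> s = int (\<omega> 0) + lift n \<omega> s] (mod int n)"
      by (intro cong_add cong_sym[OF y] cong_refl)
    also have "[int (\<omega> 0) + lift n \<omega> s = int (\<omega> s)] (mod int n)"
      by (rule cong_sym, rule lift_cong, rule \<omega>)
    finally have "?c t ! i = \<omega> s" by (rule nat_cong_imp_eq[rotated 2]) (use \<omega> cn in auto)
    with ci[of t] show ?thesis by simp
  qed
  show ?thesis
    using u
  proof (induction t)
    case 0
    have "d \<noteq> 0"
    proof
      assume "d = 0"
      then have "\<omega> 0 \<in> set (?c 0)" by (intro eq) simp
      with 0 show False by (simp add: uncaught_def caught_def)
    qed
    with d show ?case by simp
  next
    case (Suc t)
    then have ch: "chasing n d e \<omega> t" by (simp add: uncaught_Suc)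
    have ee: "e * e = 1" using e by auto
    \<comment> \<open>From gap 1 the cop's move in round \<open>Suc t\<close> lands on
      \<open>\<omega> t\<close>, before the robber can react.\<close>
    have "d + e * lift n \<omega> t - int t \<noteq> 1"
    proof
      assume "d + e * lift n \<omega> t - int t = 1"
      then have "e * (d + e * lift n \<omega> t - int t) = e * 1" by simp
      then have "e * d + lift n \<omega> t = int (Suc t) * e"
        using ee by (simp add: algebra_simps mult.assoc[symmetric])
      then have "\<omega> t \<in> set (?c (Suc t))" by (intro eq) simp
      with uncaught_Suc_imp_notin[OF Suc.prems] show False by (simp add: robber_at_drunk)
    qed
    moreover have "d + e * lift n \<omega> (Suc t) - int (Suc t) \<noteq> 0"
    proof
      assume "d + e * lift n \<omega> (Suc t) - int (Suc t) = 0"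
      then have "e * (d + e * lift n \<omega> (Suc t) - int (Suc t)) = 0" by simp
      then have "e * d + lift n \<omega> (Suc t) = int (Suc t) * e"
        using ee by (simp add: algebra_simps mult.assoc[symmetric])
      then have "\<omega> (Suc t) \<in> set (?c (Suc t))" by (intro eq) simp
      with uncaught_imp_notin[OF Suc.prems] show False by (simp add: robber_at_drunk)
    qed
    \<comment> \<open>A round changes the gap by -2 or 0, so a gap of at least 2 stays nonnegative,
      and 0 has just been excluded.\<close>
    moreover have "\<bar>e * increment n (\<omega> t) (\<omega> (Suc t))\<bar> = 1" using e by (auto simp: abs_mult)
    ultimately show ?case
      using ch chasing_ge_1[OF ch] by (simp add: lift_Suc distrib_left)
  qed
qed

lemma AE_cycle_walk:
  assumes "y < n"
  shows "AE \<omega> in walk_measure (cycle_graph n) y.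
    \<omega> 0 = y \<and> (\<forall>t. \<omega> t < n \<and> \<omega> (Suc t) \<in> nbrs (cycle_graph n) (\<omega> t))"
proof -
  have "AE \<omega> in walk_measure (cycle_graph n) y.
    \<omega> 0 = y \<and> (\<forall>t. \<omega> t \<in> verts (cycle_graph n) \<and> \<omega> (Suc t) \<in> nbrs (cycle_graph n) (\<omega> t))"
    by (rule AE_walk) (use assms finite_nonempty_nbrs_cycle_graph in auto)
  then show ?thesis by simp
qed

text \<open>The expected gap on the event that the chase is still on, \<open>q t\<close>, drops in
  each round by exactly the probability \<open>p t\<close> of that event. The sum therefore
  telescopes to \<open>q 0 - q k\<close>, which is at most \<open>d\<close>.\<close>

lemma sum_chasing_le:
  assumes n: "n \<ge> 3" "y < n" and e: "e \<in> {1, -1 :: int}" and d: "d \<ge> 0"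
  shows "(\<Sum>t<k. \<integral> \<omega>. of_bool (chasing n d e \<omega> t) \<partial>walk_measure (cycle_graph n) y) \<le> real_of_int d"
proof -
  let ?M = "walk_measure (cycle_graph n) y"
  interpret prob_space ?M by (rule prob_space_walk_measure)
  define p where "p t = (\<integral> \<omega>. (of_bool (chasing n d e \<omega> t) :: real) \<partial>?M)" for t
  define D where "D t \<omega> = real_of_int (d + e * lift n \<omega> t - int t)" for t \<omega>
  define q where "q t = (\<integral> \<omega>. D t \<omega> * of_bool (chasing n d e \<omega> t) \<partial>?M)" for t
  have detD: "determined (Suc t) (D t)" for t
    unfolding D_def by (rule determined_comp[OF determined_lift])
  have detc: "determined (Suc t) (\<lambda>\<omega>. of_bool (chasing n d e \<omega> t) :: real)" for t
    by (rule determined_comp[OF determined_chasing])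
  have D_le: "\<bar>D t \<omega>\<bar> \<le> real_of_int d + 2 * real t" for t \<omega>
  proof -
    have "\<bar>e * lift n \<omega> t\<bar> \<le> int t" using abs_lift_le[of n \<omega> t] e by (auto simp: abs_mult)
    then have "\<bar>d + e * lift n \<omega> t - int t\<bar> \<le> d + 2 * int t" using d by linarith
    then have "real_of_int \<bar>d + e * lift n \<omega> t - int t\<bar> \<le> real_of_int (d + 2 * int t)" by linarith
    then show ?thesis by (simp add: D_def)
  qed
  have int1: "integrable ?M (\<lambda>\<omega>. D t \<omega> * of_bool (chasing n d e \<omega> t))" for t
    by (rule integrable_determined[OF determined_times[OF detD detc], of _ "real_of_int d + 2 * real t"])
      (use D_le d in \<open>auto simp: of_bool_def intro: order_trans\<close>)
  have int2: "integrable ?M (\<lambda>\<omega>. of_bool (chasing n d e \<omega> t) :: real)" for t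
    by (rule integrable_determined[OF detc, of _ 1]) simp
  have step: "q (Suc t) = q t - p t" for t
  proof -
    \<comment> \<open>The robber's step counts only from gap 2 on. From gap 1 the chase ends with
      the cop's move, and there \<open>D t - 1\<close> is 0, so the identity below stays exact. A
      chase that ends at gap 0 also contributes nothing.\<close>
    let ?F = "\<lambda>\<omega>. of_bool (chasing n d e \<omega> t) * of_bool (D t \<omega> \<ge> 2) * real_of_int e"
    have det: "determined (Suc t) ?F"
      by (intro determined_times detc determined_comp[OF detD])
    have i0: "(\<integral> \<omega>. ?F \<omega> * increment n (\<omega> t) (\<omega> (Suc t)) \<partial>?M) = 0"
      by (rule integral_walk_increment[OF n det, of 1]) (use e in auto)
    have iF: "integrable ?M (\<lambda>\<omega>. ?F \<omega> * increment n (\<omega> t) (\<omega> (Suc t)))"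
      by (rule integrable_times_increment[OF det, of 1]) (use e in auto)
    have "D (Suc t) \<omega> * of_bool (chasing n d e \<omega> (Suc t)) =
        (D t \<omega> * of_bool (chasing n d e \<omega> t) - of_bool (chasing n d e \<omega> t))
          + ?F \<omega> * increment n (\<omega> t) (\<omega> (Suc t))" for \<omega>
    proof (cases "chasing n d e \<omega> t")
      case True
      define a b where "a = d + e * lift n \<omega> t - int t" and "b = e * increment n (\<omega> t) (\<omega> (Suc t))"
      have "a \<ge> 1" using chasing_ge_1[OF True] by (simp add: a_def)
      moreover have "b = 1 \<or> b = -1" using e by (auto simp: b_def increment_def)
      moreover have "D t \<omega> = real_of_int a" by (simp add: D_def a_def)
      moreover have S: "d + e * lift n \<omega> (Suc t) - int (Suc t) = a - 1 + b"
        by (simp add: lift_Suc a_def b_def algebra_simps)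
      then have "D (Suc t) \<omega> = real_of_int (a - 1 + b)" by (simp only: D_def)
      moreover have "chasing n d e \<omega> (Suc t) \<longleftrightarrow> a \<ge> 2 \<and> a - 1 + b \<ge> 1"
        using True S by (simp add: a_def)
      moreover have "?F \<omega> * increment n (\<omega> t) (\<omega> (Suc t)) = of_bool (D t \<omega> \<ge> 2) * real_of_int b"
        using True by (simp add: b_def)
      ultimately show ?thesis using True by (auto simp: of_bool_def)
    next
      case False
      then show ?thesis by simp
    qed
    then have "q (Suc t) = (\<integral> \<omega>. (D t \<omega> * of_bool (chasing n d e \<omega> t) - of_bool (chasing n d e \<omega> t))
          + ?F \<omega> * increment n (\<omega> t) (\<omega> (Suc t)) \<partial>?M)"
      unfolding q_def by (intro Bochner_Integration.integral_cong) auto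
    also have "\<dots> = q t - p t"
      unfolding q_def p_def using int1[of t] int2[of t] iF i0
      by (simp add: Bochner_Integration.integral_add Bochner_Integration.integral_diff)
    finally show ?thesis .
  qed
  have "q t \<ge> 0" for t
  proof -
    have "0 \<le> D t \<omega>" if "chasing n d e \<omega> t" for \<omega>
      using chasing_ge_1[OF that] unfolding D_def of_int_0_le_iff by linarith
    then show ?thesis unfolding q_def by (intro integral_nonneg_AE AE_I2) (simp add: of_bool_def)
  qed
  moreover have "(\<Sum>t<k. p t) = q 0 - q k"
    by (induction k) (simp_all add: step)
  moreover have "q 0 \<le> real_of_int d"
    using d by (simp add: q_def D_def prob_space)
  ultimately have "(\<Sum>t<k. p t) \<le> real_of_int d" using \<open>\<And>t. q t \<ge> 0\<close>[of k] by linarith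
  then show ?thesis by (simp add: p_def)
qed

lemma dct_from_le:
  assumes n: "n \<ge> 3" "y < n" and x: "set x \<subseteq> {0..<n}" and i: "i < length x"
    and e: "e \<in> {1, -1 :: int}" and d: "d \<ge> 0"
    and y: "[int y = int (x ! i) + e * d] (mod int n)"
  shows "dct_from (cycle_graph n) x y \<le> ennreal (real_of_int d)"
proof -
  let ?M = "walk_measure (cycle_graph n) y"
  define \<sigma> where "\<sigma> = cycle_strategy n (\<lambda>h j. if j = i then e else 0)"
  have \<sigma>: "\<sigma> \<in> cop_strategies (cycle_graph n)"
    unfolding \<sigma>_def by (rule cycle_strategy_cop_strategies) (use e in auto)
  interpret prob_space ?M by (rule prob_space_walk_measure)
  have "dct_from (cycle_graph n) x y \<le> (\<integral>\<^sup>+ \<omega>. ennreal_of_enat (capture_time \<sigma> (drunk \<omega>) x y) \<partial>?M)"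
    unfolding dct_from_def by (rule INF_lower[OF \<sigma>])
  \<comment> \<open>Survival implies that the chase is on, so the tail sums can be compared term by
    term.\<close>
  also have "\<dots> \<le> (\<integral>\<^sup>+ \<omega>. (\<Sum>t. ennreal (of_bool (chasing n d e \<omega> t))) \<partial>?M)"
  proof (rule nn_integral_mono_AE, rule AE_mp[OF AE_cycle_walk[OF n(2)] AE_I2], intro impI)
    fix \<omega> assume \<omega>: "\<omega> 0 = y \<and> (\<forall>t. \<omega> t < n \<and> \<omega> (Suc t) \<in> nbrs (cycle_graph n) (\<omega> t))"
    have "uncaught \<sigma> (drunk \<omega>) x y t \<Longrightarrow> chasing n d e \<omega> t" for t
      using uncaught_imp_chasing[of \<omega> n i x e d \<sigma> t] \<omega> i e y d x \<sigma>_def by blast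
    then show "ennreal_of_enat (capture_time \<sigma> (drunk \<omega>) x y) \<le> (\<Sum>t. ennreal (of_bool (chasing n d e \<omega> t)))"
      unfolding capture_time_eq_suminf by (intro suminf_le) (auto simp: of_bool_def)
  qed
  also have "\<dots> = (\<Sum>t. \<integral>\<^sup>+ \<omega>. ennreal (of_bool (chasing n d e \<omega> t)) \<partial>?M)"
    by (intro nn_integral_suminf measurable_determined[OF determined_comp[OF determined_chasing]]) simp
  also have "\<dots> = (\<Sum>t. ennreal (\<integral> \<omega>. of_bool (chasing n d e \<omega> t) \<partial>?M))"
  proof (rule suminf_cong, rule nn_integral_eq_integral)
    show "integrable ?M (\<lambda>\<omega>. of_bool (chasing n d e \<omega> t) :: real)" for t
      by (rule integrable_determined[where B=1]) (rule determined_comp[OF determined_chasing], simp)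
  qed simp
  also have "\<dots> \<le> ennreal (real_of_int d)"
    unfolding suminf_eq_SUP
    by (intro SUP_least) (simp add: sum_ennreal sum_chasing_le[OF n e d] ennreal_leI)
  finally show ?thesis .
qed

section \<open>Lower bound for a fixed initial vertex by optional stopping\<close>

text \<open>\<open>v\<close> is the walk stopped at capture or at time \<open>n\<close>. The horizon \<open>n\<close> makes everything bounded and
  costs nothing, as the left-hand side never exceeds \<open>n / 2\<close>.\<close>

lemma stopped_distance_le:
  assumes \<omega>: "\<And>t. \<omega> t < n \<and> \<omega> (Suc t) \<in> nbrs (cycle_graph n) (\<omega> t)"
    and \<sigma>: "\<sigma> \<in> cop_strategies (cycle_graph n)" and x: "set x \<subseteq> {0..<n}"
    and arc: "clear_arc n x lo hi" and Y: "[Y = int (\<omega> 0)] (mod int n)" and len: "hi - lo \<le> int n"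
  defines "U \<equiv> \<lambda>t. uncaught \<sigma> (drunk \<omega>) x (\<omega> 0) t"
  defines "v \<equiv> (\<Sum>t<n. of_bool (U t) * increment n (\<omega> t) (\<omega> (Suc t)))"
  shows "min (Y - lo + v) (hi - Y - v) \<le> (\<Sum>t<n. of_bool (U t)) + 1"
proof -
  define T where "T = (LEAST T. caught \<sigma> (drunk \<omega>) x (\<omega> 0) T \<or> T = n)"
  have T: "caught \<sigma> (drunk \<omega>) x (\<omega> 0) T \<or> T = n"
    unfolding T_def by (rule LeastI[of _ n]) simp
  have "T \<le> n" unfolding T_def by (rule Least_le) simp
  have U: "U t \<longleftrightarrow> t < T" if "t < n" for t
  proof
    assume "t < T"
    then have "\<not> caught \<sigma> (drunk \<omega>) x (\<omega> 0) s" if "s \<le> t" for s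
      using not_less_Least[of s "\<lambda>T. caught \<sigma> (drunk \<omega>) x (\<omega> 0) T \<or> T = n"] that by (simp add: T_def)
    then show "U t" by (simp add: U_def uncaught_def)
  next
    assume "U t"
    show "t < T"
    proof (rule ccontr)
      assume "\<not> t < T"
      with T that have "caught \<sigma> (drunk \<omega>) x (\<omega> 0) T" by auto
      with \<open>U t\<close> \<open>\<not> t < T\<close> show False by (simp add: U_def uncaught_def)
    qed
  qed
  have sub: "{..<T} \<subseteq> {..<n}" using \<open>T \<le> n\<close> by auto
  have "(\<Sum>t<n. of_bool (U t)) = (\<Sum>t<T. 1 :: int)"
    using sub U by (intro sum.mono_neutral_cong_right) auto
  then have s1: "(\<Sum>t<n. of_bool (U t)) = int T" by simp
  have s2: "v = lift n \<omega> T"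
    unfolding v_def lift_def using sub U by (intro sum.mono_neutral_cong_right) auto
  show ?thesis
  proof (cases "caught \<sigma> (drunk \<omega>) x (\<omega> 0) T")
    case True
    have "min ((Y + lift n \<omega> T) - lo) (hi - (Y + lift n \<omega> T)) \<le> int T + 1"
    proof (rule caught_imp_distance_le[OF \<sigma> x _ arc _ _ True])
      show "[Y + lift n \<omega> t = int (robber_at \<sigma> (drunk \<omega>) x (\<omega> 0) t)] (mod int n)" for t
        unfolding robber_at_drunk
        using cong_trans[OF cong_add[OF Y cong_refl] cong_sym[OF lift_cong[of \<omega> n t]]] \<omega> by blast
    qed (use \<omega> in \<open>simp_all add: robber_at_drunk lift_Suc\<close>)
    then show ?thesis unfolding s1 s2 by (simp add: algebra_simps)
  next
    case False
    with T have "T = n" by simp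
    then show ?thesis unfolding s1 using len by simp
  qed
qed

text \<open>\<open>V n\<close> is the walk and \<open>K n\<close> the clock, both stopped at capture
  or at the horizon \<open>n\<close>; being bounded, they have moments of all orders. The estimate
  holds for each strategy separately. If \<open>D = 0\<close>, the asserted bound is 0.\<close>

lemma dct_from_ge:
  fixes lo hi Y :: int
  assumes n: "n \<ge> 3" "y < n" and x: "set x \<subseteq> {0..<n}" and arc: "clear_arc n x lo hi"
    and Y: "[Y = int y] (mod int n)" and len: "hi - lo \<le> int n"
  defines "m \<equiv> real_of_int (min (Y - lo) (hi - Y))"
  defines "D \<equiv> real_of_int \<bar>(hi - Y) - (Y - lo)\<bar>"
  shows "ennreal ((m - 1) * (D / (D + 1))) \<le> dct_from (cycle_graph n) x y"
proof (cases "D = 0")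
  case False
  then have D1: "D > 0" unfolding D_def by simp
  let ?M = "walk_measure (cycle_graph n) y"
  interpret prob_space ?M by (rule prob_space_walk_measure)
  show ?thesis
    unfolding dct_from_def
  proof (rule INF_greatest)
    fix \<sigma> assume \<sigma>: "\<sigma> \<in> cop_strategies (cycle_graph n)"
    define U where "U t \<omega> = (of_bool (uncaught \<sigma> (drunk \<omega>) x y t) :: real)" for t \<omega>
    define V where "V k \<omega> = (\<Sum>t<k. U t \<omega> * increment n (\<omega> t) (\<omega> (Suc t)))" for k \<omega>
    define K where "K k \<omega> = (\<Sum>t<k. U t \<omega>)" for k \<omega>
    have dU: "determined (Suc t) (U t)" for t
      unfolding U_def by (rule determined_comp[OF determined_uncaught])
    have U1: "\<bar>U t \<omega>\<bar> \<le> 1" "U t \<omega> * U t \<omega> = U t \<omega>" for t \<omega> by (simp_all add: U_def)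
    have dV: "determined (Suc k) (V k)" for k
      unfolding V_def
      by (intro determined_sum determined_times determined_mono[OF dU] determined_comp[OF determined_increment]) auto
    have dK: "determined (Suc k) (K k)" for k
      unfolding K_def by (intro determined_sum determined_mono[OF dU]) auto
    have V_le: "\<bar>V k \<omega>\<bar> \<le> real k" for k \<omega>
    proof -
      have "\<bar>V k \<omega>\<bar> \<le> (\<Sum>t<k. 1)"
        unfolding V_def using U1 by (intro order_trans[OF sum_abs] sum_mono) (simp add: abs_mult)
      then show ?thesis by simp
    qed
    have K_le: "\<bar>K k \<omega>\<bar> \<le> real k" for k \<omega>
    proof -
      have "\<bar>K k \<omega>\<bar> \<le> (\<Sum>t<k. 1)"
        unfolding K_def using U1 by (intro order_trans[OF sum_abs] sum_mono) simp
      then show ?thesis by simp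
    qed
    have V2_le: "\<bar>(V k \<omega>)\<^sup>2\<bar> \<le> (real k)\<^sup>2" for k \<omega>
      using V_le[of k \<omega>] by (simp add: abs_le_square_iff[symmetric])
    have iV: "integrable ?M (V k)" and iK: "integrable ?M (K k)" and iV2: "integrable ?M (\<lambda>\<omega>. (V k \<omega>)\<^sup>2)" for k
      using integrable_determined[OF dV V_le] integrable_determined[OF dK K_le]
        integrable_determined[OF determined_comp[OF dV, where g="\<lambda>r. r\<^sup>2"] V2_le] by blast+
    have iU: "integrable ?M (U k)" for k by (rule integrable_determined[OF dU U1(1)])
    have iUI: "integrable ?M (\<lambda>\<omega>. U t \<omega> * increment n (\<omega> t) (\<omega> (Suc t)))" for t
      by (rule integrable_times_increment[OF dU U1(1)])
    have dVU: "determined (Suc k) (\<lambda>\<omega>. 2 * V k \<omega> * U k \<omega>)" for k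
      by (intro determined_times dU dV) (simp add: determined_def)
    have VU_le: "\<bar>2 * V k \<omega> * U k \<omega>\<bar> \<le> 2 * real k" for k \<omega>
      using V_le[of k \<omega>] by (auto simp: U_def of_bool_def abs_mult)
    have EV: "(\<integral> \<omega>. V k \<omega> \<partial>?M) = 0" for k
      unfolding V_def using iUI integral_walk_increment[OF n dU U1(1)]
      by (subst Bochner_Integration.integral_sum) auto
    \<comment> \<open>The second Wald identity. Since \<open>U\<close> is an indicator and
      increments are signs, each squared increment adds \<open>U k\<close>, while the cross term has
      mean zero because \<open>2 * V k * U k\<close> is determined before the step.\<close>
    have EV2: "(\<integral> \<omega>. (V k \<omega>)\<^sup>2 \<partial>?M) = (\<integral> \<omega>. K k \<omega> \<partial>?M)" for k
    proof (induction k)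
      case 0
      then show ?case by (simp add: V_def K_def)
    next
      case (Suc k)
      have KS: "K (Suc k) = (\<lambda>\<omega>. K k \<omega> + U k \<omega>)"
        by (simp add: K_def fun_eq_iff)
      have "(V (Suc k) \<omega>)\<^sup>2 = ((V k \<omega>)\<^sup>2 + U k \<omega>) + 2 * V k \<omega> * U k \<omega> * increment n (\<omega> k) (\<omega> (Suc k))" for \<omega>
        by (auto simp: V_def U_def increment_def of_bool_def power2_eq_square algebra_simps)
      then have "(\<integral> \<omega>. (V (Suc k) \<omega>)\<^sup>2 \<partial>?M) = (\<integral> \<omega>. ((V k \<omega>)\<^sup>2 + U k \<omega>)
          + 2 * V k \<omega> * U k \<omega> * increment n (\<omega> k) (\<omega> (Suc k)) \<partial>?M)"
        by (intro Bochner_Integration.integral_cong) auto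
      also have "\<dots> = (\<integral> \<omega>. (V k \<omega>)\<^sup>2 \<partial>?M) + (\<integral> \<omega>. U k \<omega> \<partial>?M)"
        using iV2[of k] iU[of k] integrable_times_increment[OF dVU VU_le, of "cycle_graph n" y k n]
          integral_walk_increment[OF n dVU VU_le, of k]
        by (simp add: Bochner_Integration.integral_add)
      also have "\<dots> = (\<integral> \<omega>. K (Suc k) \<omega> \<partial>?M)"
        using Suc iK[of k] iU[of k] by (simp add: KS)
      finally show ?case .
    qed
    \<comment> \<open>The sign with which the walk changes the distance to the nearer end of the
      arc.\<close>
    define e :: real where "e = (if Y - lo \<le> hi - Y then 1 else -1)"
    have AE: "AE \<omega> in ?M. m + e * V n \<omega> - (V n \<omega>)\<^sup>2 / D \<le> K n \<omega> + 1"
    proof (rule AE_mp[OF AE_cycle_walk[OF n(2)] AE_I2], intro impI)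
      fix \<omega> assume \<omega>: "\<omega> 0 = y \<and> (\<forall>t. \<omega> t < n \<and> \<omega> (Suc t) \<in> nbrs (cycle_graph n) (\<omega> t))"
      define v where "v = (\<Sum>t<n. of_bool (uncaught \<sigma> (drunk \<omega>) x y t) * increment n (\<omega> t) (\<omega> (Suc t)))"
      have "min (Y - lo + v) (hi - Y - v) \<le> (\<Sum>t<n. of_bool (uncaught \<sigma> (drunk \<omega>) x y t)) + 1"
        using stopped_distance_le[of \<omega> n \<sigma> x lo hi Y] \<omega> \<sigma> x arc Y len unfolding v_def by blast
      then have "real_of_int (min (Y - lo + v) (hi - Y - v)) \<le>
          real_of_int ((\<Sum>t<n. of_bool (uncaught \<sigma> (drunk \<omega>) x y t)) + 1)" by linarith
      moreover have "V n \<omega> = real_of_int v" by (simp add: V_def v_def U_def)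
      ultimately have min_le: "min (real_of_int (Y - lo) + V n \<omega>) (real_of_int (hi - Y) - V n \<omega>) \<le> K n \<omega> + 1"
        by (simp add: K_def U_def of_int_min)
      \<comment> \<open>A quadratic minorant of the minimum: it lies below \<open>r + w\<close> by
        \<open>w\<^sup>2 / D\<close> and below \<open>r + D - w\<close> by
        \<open>(D - w)\<^sup>2 / D\<close>. Unlike the minimum, it has an expectation that the first
        two moments determine.\<close>
      have key: "r + w - w\<^sup>2 / D \<le> min (r + w) (r + D - w)" for r w :: real
      proof -
        have "0 \<le> (D - w)\<^sup>2 / D" using D1 by simp
        also have "(D - w)\<^sup>2 / D = D - 2 * w + w\<^sup>2 / D"
          using D1 by (simp add: power2_eq_square field_simps)
        finally show ?thesis using D1 by simp
      qed
      show "m + e * V n \<omega> - (V n \<omega>)\<^sup>2 / D \<le> K n \<omega> + 1"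
      proof (cases "Y - lo \<le> hi - Y")
        case True
        then have "real_of_int (hi - Y) = m + D" "real_of_int (Y - lo) = m" "e = 1"
          by (simp_all add: m_def D_def e_def)
        then have "min (m + V n \<omega>) (m + D - V n \<omega>) \<le> K n \<omega> + 1" using min_le by simp
        with key[of m "V n \<omega>"] have "m + V n \<omega> - (V n \<omega>)\<^sup>2 / D \<le> K n \<omega> + 1" by linarith
        with \<open>e = 1\<close> show ?thesis by simp
      next
        case False
        then have "real_of_int (Y - lo) = m + D" "real_of_int (hi - Y) = m" "e = -1"
          by (simp_all add: m_def D_def e_def)
        then have "min (m - V n \<omega>) (m + D + V n \<omega>) \<le> K n \<omega> + 1" using min_le by (simp add: min.commute)
        moreover have "m - V n \<omega> - (V n \<omega>)\<^sup>2 / D \<le> min (m - V n \<omega>) (m + D + V n \<omega>)"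
          using key[of m "- V n \<omega>"] by (simp only: power2_minus add_uminus_conv_diff diff_minus_eq_add)
        ultimately have "m - V n \<omega> - (V n \<omega>)\<^sup>2 / D \<le> K n \<omega> + 1" by linarith
        with \<open>e = -1\<close> show ?thesis by simp
      qed
    qed
    define k where "k = (\<integral> \<omega>. K n \<omega> \<partial>?M)"
    have "(\<integral> \<omega>. m + e * V n \<omega> - (V n \<omega>)\<^sup>2 / D \<partial>?M) \<le> (\<integral> \<omega>. K n \<omega> + 1 \<partial>?M)"
      by (rule integral_mono_AE) (use AE iV[of n] iK[of n] iV2[of n] in auto)
    \<comment> \<open>The linear term has mean 0 and the quadratic one has mean
      \<open>k / D\<close>; solving for \<open>k\<close> gives the factor
      \<open>D / (D + 1)\<close>.\<close>
    then have "m - k / D \<le> k + 1"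
      using iV[of n] iK[of n] iV2[of n] by (simp add: EV EV2 k_def prob_space[simplified])
    then have "(m - 1) * D \<le> k * (D + 1)"
      using D1 by (simp add: field_simps)
    then have "(m - 1) * (D / (D + 1)) \<le> k"
      using D1 by (simp add: field_simps)
    then have "ennreal ((m - 1) * (D / (D + 1))) \<le> ennreal k" by (rule ennreal_leI)
    also have "\<dots> = (\<integral>\<^sup>+ \<omega>. ennreal (K n \<omega>) \<partial>?M)"
      unfolding k_def using iK by (intro nn_integral_eq_integral[symmetric]) (auto simp: K_def U_def intro!: sum_nonneg)
    \<comment> \<open>\<open>K n\<close> is the partial sum, up to the horizon, of the tail-sum
      series for the capture time.\<close>
    also have "\<dots> \<le> (\<integral>\<^sup>+ \<omega>. ennreal_of_enat (capture_time \<sigma> (drunk \<omega>) x y) \<partial>?M)"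
    proof (rule nn_integral_mono)
      fix \<omega>
      have "ennreal (K n \<omega>) = (\<Sum>t<n. ennreal (U t \<omega>))"
        unfolding K_def by (subst sum_ennreal) (simp_all add: U_def)
      also have "\<dots> = (\<Sum>t<n. of_bool (uncaught \<sigma> (drunk \<omega>) x y t))"
        by (intro sum.cong) (simp_all add: U_def of_bool_def)
      also have "\<dots> \<le> ennreal_of_enat (capture_time \<sigma> (drunk \<omega>) x y)"
        unfolding capture_time_eq_suminf by (rule sum_le_suminf) auto
      finally show "ennreal (K n \<omega>) \<le> ennreal_of_enat (capture_time \<sigma> (drunk \<omega>) x y)" .
    qed
    finally show "ennreal ((m - 1) * (D / (D + 1))) \<le>
      (\<integral>\<^sup>+ \<omega>. ennreal_of_enat (capture_time \<sigma> (drunk \<omega>) x y) \<partial>?M)" .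
  qed
qed simp

section \<open>The adversarial robber on the cycle\<close>

definition stay :: "'a robber_strategy" where
  "stay h x' = snd (last h)"

lemma stay_robber_strategies: "stay \<in> robber_strategies G"
  by (simp add: robber_strategies_def stay_def closed_nbrs_def)

lemma robber_at_stay [simp]: "robber_at \<sigma> stay x y t = y"
  by (induction t) (simp_all add: robber_at_Suc stay_def last_play)

lemma not_cops_win_0: "verts G \<noteq> {} \<Longrightarrow> \<not> cops_win G 0"
proof
  assume "verts G \<noteq> {}" "cops_win G 0"
  then obtain y \<sigma> where y: "y \<in> verts G" and \<sigma>: "\<sigma> \<in> cop_strategies G"
    and fin: "capture_time \<sigma> stay [] y < \<infinity>"
    using stay_robber_strategies unfolding cops_win_def cop_positions_def by fastforce
  have "cops_at \<sigma> stay [] y t = []" for t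
    using cops_at_verts[OF \<sigma>, of "[]" stay y t] y by simp
  then have "capture_time \<sigma> stay [] y = \<infinity>"
    by (intro capture_time_infinity) (simp add: uncaught_def caught_def)
  with fin show False by simp
qed

text \<open>If \<open>y\<close> is adjacent to \<open>u\<close>, one more step in the same direction
  leads to distance 2, which is out of reach of \<open>u\<close> when \<open>n \<ge> 4\<close>.
  Otherwise \<open>y\<close> itself is a witness.\<close>

lemma closed_nbrs_cycle_graph_diff:
  assumes n: "n \<ge> 4" and "u < n" "y < n" "y \<noteq> u"
  shows "\<exists>v\<in>closed_nbrs (cycle_graph n) y. v \<notin> closed_nbrs (cycle_graph n) u"
proof (cases "y \<in> closed_nbrs (cycle_graph n) u")
  case True
  then obtain e where e: "\<bar>e\<bar> \<le> 1" "[int y = int u + e] (mod int n)"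
    using closed_nbrs_cycle_graph_cong[OF \<open>u < n\<close>] by blast
  have "e \<noteq> 0"
    using e(2) assms by (auto simp: cong_def)
  define v where "v = nat ((int y + e) mod int n)"
  have v: "v < n" "[int v = int y + e] (mod int n)"
    using n by (simp_all add: v_def cong_def nat_less_iff)
  have "v \<in> closed_nbrs (cycle_graph n) y"
    by (rule closed_nbrs_cycle_graphI[OF \<open>y < n\<close> v(1) e(1) v(2)])
  moreover have "v \<notin> closed_nbrs (cycle_graph n) u"
  proof
    assume "v \<in> closed_nbrs (cycle_graph n) u"
    then obtain e' where e': "\<bar>e'\<bar> \<le> 1" "[int v = int u + e'] (mod int n)"
      using closed_nbrs_cycle_graph_cong[OF \<open>u < n\<close>] by blast
    have "[int u + e' = int u + e + e] (mod int n)"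
      using cong_trans[OF cong_sym[OF e'(2)] cong_trans[OF v(2) cong_add[OF e(2) cong_refl]]] .
    then have "int n dvd e' - 2 * e"
      by (simp add: cong_iff_dvd_diff algebra_simps)
    \<comment> \<open>The absolute value lies between 1 and 3, so \<open>n \<ge> 4\<close> cannot
      divide it.\<close>
    moreover have "e' - 2 * e \<noteq> 0" using \<open>e \<noteq> 0\<close> e'(1) by auto
    ultimately have "int n \<le> \<bar>e' - 2 * e\<bar>"
      using zdvd_imp_le[of "int n" "\<bar>e' - 2 * e\<bar>"] by simp
    with n e(1) e'(1) show False by linarith
  qed
  ultimately show ?thesis by blast
qed (auto simp: closed_nbrs_def)

text \<open>Aimed at a single cop, \<open>hd x'\<close>. Staying put is the fallback that keeps the
  strategy legal on every history.\<close>

definition evade :: "'a graph \<Rightarrow> 'a robber_strategy" where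
  "evade G h x' =
     (if closed_nbrs G (snd (last h)) \<subseteq> closed_nbrs G (hd x') then snd (last h)
      else SOME v. v \<in> closed_nbrs G (snd (last h)) - closed_nbrs G (hd x'))"

lemma evade_in_Diff:
  assumes "v \<in> closed_nbrs G (snd (last h))" "v \<notin> closed_nbrs G (hd x')"
  shows "evade G h x' \<in> closed_nbrs G (snd (last h)) - closed_nbrs G (hd x')"
proof -
  have "evade G h x' = (SOME v. v \<in> closed_nbrs G (snd (last h)) - closed_nbrs G (hd x'))"
    using assms unfolding evade_def by (subst if_not_P) blast+
  then show ?thesis
    using someI[of "\<lambda>v. v \<in> closed_nbrs G (snd (last h)) - closed_nbrs G (hd x')" v] assms by simp
qed

lemma evade_robber_strategies: "evade G \<in> robber_strategies G"
proof -
  have "evade G h x' \<in> closed_nbrs G (snd (last h))" for h x'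
  proof (cases "closed_nbrs G (snd (last h)) \<subseteq> closed_nbrs G (hd x')")
    case True
    then show ?thesis by (simp add: evade_def closed_nbrs_def)
  next
    case False
    then obtain v where "v \<in> closed_nbrs G (snd (last h))" "v \<notin> closed_nbrs G (hd x')" by blast
    from evade_in_Diff[OF this] show ?thesis by simp
  qed
  from this[of "h @ [(x, y)]" for h x y] show ?thesis by (simp add: robber_strategies_def)
qed

text \<open>The robber keeps outside the closed neighbourhood of the cop after each of his moves, so
  the cop's next move cannot reach him.\<close>

lemma not_cops_win_1_cycle_graph:
  assumes n: "n \<ge> 4"
  shows "\<not> cops_win (cycle_graph n) 1"
proof
  let ?G = "cycle_graph n"
  assume "cops_win ?G 1"
  then obtain x \<sigma> where x: "x \<in> cop_positions ?G 1" and \<sigma>: "\<sigma> \<in> cop_strategies ?G"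
    and win: "\<And>y \<rho>. y \<in> verts ?G \<Longrightarrow> \<rho> \<in> robber_strategies ?G \<Longrightarrow> capture_time \<sigma> \<rho> x y < \<infinity>"
    unfolding cops_win_def by blast
  from x obtain p where p: "x = [p]" "p < n"
    by (auto simp: cop_positions_def length_Suc_conv)
  \<comment> \<open>With at most 3 vertices in the closed neighbourhood and
    \<open>n \<ge> 4\<close>, a safe initial vertex exists.\<close>
  have "card (closed_nbrs ?G p) \<le> 3"
    using p by (simp add: closed_nbrs_def nbrs_cycle_graph card_insert_if)
  then have "\<not> {0..<n} \<subseteq> closed_nbrs ?G p"
    using n p card_mono[of "closed_nbrs ?G p" "{0..<n}"] by (auto simp: closed_nbrs_def nbrs_cycle_graph)
  then obtain y where "y \<in> {0..<n}" and y': "y \<notin> closed_nbrs ?G p" by blast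
  then have y: "y < n" "y \<notin> closed_nbrs ?G p" by simp_all
  let ?c = "cops_at \<sigma> (evade ?G) x y" and ?r = "robber_at \<sigma> (evade ?G) x y"
  have pv: "set (?c t) \<subseteq> {0..<n} \<and> ?r t \<in> {0..<n}" for t
    using play_verts[OF \<sigma> evade_robber_strategies, of x y t] p y by simp
  have len: "length (?c t) = 1" for t
    using cops_at_verts[OF \<sigma>, of x "evade ?G" y t] pv p by simp
  define c where "c t = hd (?c t)" for t
  have c: "?c t = [c t]" for t
    using len[of t] by (auto simp: c_def length_Suc_conv)
  have cn: "c t < n" and rn: "?r t < n" for t
    using pv[of t] by (simp_all add: c)
  have inv: "?r t \<notin> closed_nbrs ?G (c t) \<and> uncaught \<sigma> (evade ?G) x y t" for t
  proof (induction t)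
    case 0
    then show ?case using y p by (auto simp: c_def uncaught_def caught_def closed_nbrs_def)
  next
    case (Suc t)
    have "c (Suc t) \<in> closed_nbrs ?G (c t)"
      using cops_move[OF \<sigma>, of "evade ?G" x y t] pv[of t] by (simp add: c)
    with Suc have ne: "?r t \<noteq> c (Suc t)" by auto
    obtain v where v: "v \<in> closed_nbrs ?G (?r t)" "v \<notin> closed_nbrs ?G (c (Suc t))"
      using closed_nbrs_cycle_graph_diff[OF n cn rn ne] by blast
    have "?r (Suc t) \<notin> closed_nbrs ?G (c (Suc t))"
      using evade_in_Diff[of v ?G "play \<sigma> (evade ?G) x y t" "?c (Suc t)"] v
      by (simp add: robber_at_Suc last_play c)
    moreover from this have "?r (Suc t) \<noteq> c (Suc t)" by (auto simp: closed_nbrs_def)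
    ultimately show ?case
      using Suc ne by (simp add: uncaught_Suc caught_def c)
  qed
  have "capture_time \<sigma> (evade ?G) x y = \<infinity>"
    by (rule capture_time_infinity) (use inv in blast)
  with win[OF _ evade_robber_strategies, of y] y show False by simp
qed

section \<open>Two cops squeeze the robber\<close>

text \<open>The robber cannot jump over a cop: his lift stays strictly between the lifts of the two
  cops closing in on him.\<close>

lemma squeezed:
  assumes \<sigma>: "\<sigma> \<in> cop_strategies (cycle_graph n)" and \<rho>: "\<rho> \<in> robber_strategies (cycle_graph n)"
    and x: "set x \<subseteq> {0..<n}" "i < length x" "j < length x" and y: "y < n"
    and ci: "\<And>t. [int (cops_at \<sigma> \<rho> x y t ! i) = lo + int t] (mod int n)"
    and cj: "\<And>t. [int (cops_at \<sigma> \<rho> x y t ! j) = hi - int t] (mod int n)"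
    and Y: "[int y = Y] (mod int n)" "lo \<le> Y" "Y \<le> hi"
    and u: "uncaught \<sigma> \<rho> x y t"
  shows "\<exists>R. [int (robber_at \<sigma> \<rho> x y t) = R] (mod int n) \<and> lo + int t < R \<and> R < hi - int t"
proof -
  let ?c = "cops_at \<sigma> \<rho> x y" and ?r = "robber_at \<sigma> \<rho> x y"
  have pv: "set (?c t) \<subseteq> {0..<n} \<and> ?r t < n" for t
    using play_verts[OF \<sigma> \<rho>, of x y t] x y by simp
  have len: "length (?c t) = length x" for t
    using cops_at_verts[OF \<sigma>, of x \<rho> y t] pv x by simp
  have caught: "?r s \<in> set (?c t)"
    if "[int (?r s) = R] (mod int n)" "[int (?c t ! k) = R] (mod int n)" "k < length x" for s t k R
  proof -
    have k: "?c t ! k \<in> set (?c t)" using len that(3) by simp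
    then have "?c t ! k \<in> {0..<n}" using pv by blast
    then have "?r s = ?c t ! k"
      using pv[of s] cong_trans[OF that(1) cong_sym[OF that(2)]] by (intro nat_cong_imp_eq) simp_all
    with k show ?thesis by simp
  qed
  show ?thesis
    using u
  proof (induction t)
    case 0
    then have "?r 0 \<notin> set (?c 0)" by (rule uncaught_imp_notin)
    then have "Y \<noteq> lo" "Y \<noteq> hi"
      using caught[of 0 Y 0 i] caught[of 0 Y 0 j] ci[of 0] cj[of 0] x Y by auto
    with Y show ?case by (intro exI[of _ Y]) auto
  next
    case (Suc t)
    then obtain R where R: "[int (?r t) = R] (mod int n)" "lo + int t < R" "R < hi - int t"
      by (auto simp: uncaught_Suc)
    have "?r (Suc t) \<in> closed_nbrs (cycle_graph n) (?r t)"
      using pv[of t] by (intro robber_move[OF \<sigma> \<rho>]) simp_all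
    then obtain e where e: "\<bar>e\<bar> \<le> 1" "[int (?r (Suc t)) = int (?r t) + e] (mod int n)"
      using closed_nbrs_cycle_graph_cong pv by blast
    have R': "[int (?r (Suc t)) = R + e] (mod int n)"
      by (rule cong_trans[OF e(2) cong_add[OF R(1) cong_refl]])
    \<comment> \<open>First the cops' moves miss him, so each leaves him at distance at least 1;
      then his own unit step cannot cross a cop and does not land on one.\<close>
    have "R \<noteq> lo + int (Suc t)" "R \<noteq> hi - int (Suc t)"
      using uncaught_Suc_imp_notin[OF Suc.prems] R(1) caught ci[of "Suc t"] cj[of "Suc t"] x(2,3) by metis+
    moreover have "R + e \<noteq> lo + int (Suc t)" "R + e \<noteq> hi - int (Suc t)"
      using uncaught_imp_notin[OF Suc.prems] R' caught ci[of "Suc t"] cj[of "Suc t"] x(2,3) by metis+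
    ultimately show ?case
      using R R' e(1) by (intro exI[of _ "R + e"]) auto
  qed
qed

text \<open>The initial vertex of the robber, read off \<open>hd h\<close>, decides once and for all
  which of the two arcs the cops close.\<close>

definition squeeze :: "nat \<Rightarrow> nat cop_strategy" where
  "squeeze n = cycle_strategy n
     (\<lambda>h j. (if snd (hd h) \<le> n div 2 then 1 else -1) * (if j = 0 then 1 else -1))"

lemma squeeze_cop_strategies: "squeeze n \<in> cop_strategies (cycle_graph n)"
  unfolding squeeze_def by (rule cycle_strategy_cop_strategies) auto

text \<open>Either arc has length at most \<open>n - n div 2\<close> and shrinks by 2 per round, so
  no room is left after \<open>n div 4 + 1\<close> rounds.\<close>

lemma capture_time_squeeze_le:
  assumes n: "n \<ge> 2" and y: "y < n" and \<rho>: "\<rho> \<in> robber_strategies (cycle_graph n)"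
  shows "capture_time (squeeze n) \<rho> [0, n div 2] y \<le> enat (n div 4 + 1)"
proof -
  let ?x = "[0, n div 2]" and ?t = "n div 4 + 1"
  define e :: int where "e = (if y \<le> n div 2 then 1 else -1)"
  have c: "[int (cops_at (squeeze n) \<rho> ?x y t ! j) = int (?x ! j) + int t * (e * (if j = 0 then 1 else -1))] (mod int n)"
    if "j < 2" for j t
    unfolding squeeze_def
    using that n by (intro conjunct2[OF cops_at_cycle_strategy]) (auto simp: e_def)
  have x: "set ?x \<subseteq> {0..<n}" using n by simp
  have "\<not> uncaught (squeeze n) \<rho> ?x y ?t"
  proof
    assume u: "uncaught (squeeze n) \<rho> ?x y ?t"
    show False
    proof (cases "y \<le> n div 2")
      case True
      have "\<exists>R. [int (robber_at (squeeze n) \<rho> ?x y ?t) = R] (mod int n) \<and> 0 + int ?t < R \<and> R < int (n div 2) - int ?t"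
        using True c[of 0] c[of 1] by (intro squeezed[OF squeeze_cop_strategies \<rho> x _ _ y, of 0 1 _ _ "int y"] u) (auto simp: e_def)
      then show False by linarith
    next
      case False
      \<comment> \<open>On the second arc the cop starting at \<open>0\<close> is lifted to
        \<open>n\<close> and becomes the upper end.\<close>
      have "[int (cops_at (squeeze n) \<rho> ?x y t ! 0) = int n - int t] (mod int n)" for t
        using c[of 0 t] False by (simp add: e_def cong_def)
      then have "\<exists>R. [int (robber_at (squeeze n) \<rho> ?x y ?t) = R] (mod int n) \<and> int (n div 2) + int ?t < R \<and> R < int n - int ?t"
        using False y c[of 1] by (intro squeezed[OF squeeze_cop_strategies \<rho> x _ _ y, of 1 0 _ _ "int y"] u) (auto simp: e_def)
      then show False by linarith
    qed
  qed
  then obtain s where "s \<le> ?t" "caught (squeeze n) \<rho> ?x y s" by (auto simp: uncaught_def)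
  then show ?thesis using capture_time_le[of "squeeze n" \<rho> ?x y s] by (meson enat_ord_simps(1) order_trans)
qed

lemma cop_positions_antipodal: "n \<ge> 2 \<Longrightarrow> [0, n div 2] \<in> cop_positions (cycle_graph n) 2"
  by (simp add: cop_positions_def)

lemma cop_number_cycle_graph:
  assumes n: "n \<ge> 4"
  shows "cop_number (cycle_graph n) = 2"
  unfolding cop_number_def
proof (rule Least_equality)
  have "capture_time (squeeze n) \<rho> [0, n div 2] y < \<infinity>"
    if "y \<in> verts (cycle_graph n)" "\<rho> \<in> robber_strategies (cycle_graph n)" for y \<rho>
    by (rule le_less_trans[OF capture_time_squeeze_le]) (use that n in simp_all)
  then show "cops_win (cycle_graph n) 2"
    unfolding cops_win_def using cop_positions_antipodal[of n] squeeze_cop_strategies n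
    by (intro bexI[of _ "[0, n div 2]"] bexI[of _ "squeeze n"]) auto
  show "2 \<le> k" if "cops_win (cycle_graph n) k" for k
  proof (rule ccontr)
    assume "\<not> 2 \<le> k"
    then have "k = 0 \<or> k = 1" by auto
    with that n not_cops_win_0[of "cycle_graph n"] not_cops_win_1_cycle_graph[OF n] show False by auto
  qed
qed

section \<open>Arcs cut out by two cops, and the capture time\<close>

text \<open>The sorted positions of the two cops split the cycle into two arcs, the second one
  crossing vertex \<open>0\<close>. If the cops coincide, the first arc is degenerate and the second
  goes once around.\<close>

lemma clear_arcs:
  assumes "x \<in> cop_positions (cycle_graph n) 2"
  obtains u v where "u \<le> v" "v < n" "clear_arc n x (int u) (int v)" "clear_arc n x (int v) (int u + int n)"
proof -
  from assms obtain p q where pq: "x = [p, q]" "p < n" "q < n"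
    by (auto simp: cop_positions_def length_Suc_conv numeral_2_eq_2)
  define u v where "u = min p q" and "v = max p q"
  \<comment> \<open>These cases eliminate the product \<open>k * int n\<close>, which linear
    arithmetic cannot treat.\<close>
  have k: "k * int n \<le> - int n \<or> k * int n = 0 \<or> int n \<le> k * int n" for k
  proof -
    consider "k \<le> -1" | "k = 0" | "1 \<le> k" by linarith
    then show ?thesis
      by cases (use mult_right_mono[of k "-1" "int n"] mult_right_mono[of 1 k "int n"] in simp_all)
  qed
  show ?thesis
  proof
    show "u \<le> v" "v < n" using pq by (auto simp: u_def v_def)
    have uv: "int w = int u \<or> int w = int v" if "w \<in> set x" for w
      using that pq by (auto simp: u_def v_def)
    have b: "int u \<le> int v" "int v < int n" using \<open>u \<le> v\<close> \<open>v < n\<close> by simp_all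
    show "clear_arc n x (int u) (int v)"
      unfolding clear_arc_def
    proof (intro ballI allI)
      fix w k assume "w \<in> set x"
      from uv[OF this] k[of k] b show "int w + k * int n \<le> int u \<or> int v \<le> int w + k * int n"
        by (elim disjE) linarith+
    qed
    show "clear_arc n x (int v) (int u + int n)"
      unfolding clear_arc_def
    proof (intro ballI allI)
      fix w k assume "w \<in> set x"
      from uv[OF this] k[of k] b show "int w + k * int n \<le> int v \<or> int u + int n \<le> int w + k * int n"
        by (elim disjE) linarith+
    qed
  qed
qed

lemma ct_cycle_graph_le:
  assumes n: "n \<ge> 4"
  shows "ct (cycle_graph n) \<le> enat (n div 4 + 1)"
proof -
  have "ct_from (cycle_graph n) [0, n div 2] y \<le> enat (n div 4 + 1)" if "y < n" for y
    unfolding ct_from_def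
    by (rule INF_lower2[OF squeeze_cop_strategies], rule SUP_least, rule capture_time_squeeze_le)
      (use that n in auto)
  then show ?thesis
    unfolding ct_def cop_number_cycle_graph[OF n] ct_with_def
    using n by (intro INF_lower2[OF cop_positions_antipodal] SUP_least) auto
qed

text \<open>The longer arc has length \<open>L\<close> with \<open>n \<le> 2 * L\<close>, so its
  middle is at least \<open>n div 4\<close> from both ends. \<open>stay\<close> serves as the
  robber's answer to every cop strategy.\<close>

lemma ct_cycle_graph_ge:
  assumes n: "n \<ge> 4"
  shows "enat (n div 4 - 1) \<le> ct (cycle_graph n)"
  unfolding ct_def cop_number_cycle_graph[OF n] ct_with_def
proof (rule INF_greatest)
  fix x assume x: "x \<in> cop_positions (cycle_graph n) 2"
  obtain s L where arc: "clear_arc n x (int s) (int s + int L)" and L: "n \<le> 2 * L"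
  proof -
    obtain u v where uv: "u \<le> v" "v < n" "clear_arc n x (int u) (int v)" "clear_arc n x (int v) (int u + int n)"
      using clear_arcs[OF x] .
    show thesis
    proof (cases "n \<le> 2 * (v - u)")
      case True
      then show ?thesis using that[of u "v - u"] uv by (simp add: of_nat_diff)
    next
      case False
      then show ?thesis using that[of v "u + n - v"] uv by (simp add: of_nat_diff)
    qed
  qed
  define y where "y = (s + L div 2) mod n"
  have y: "y < n" using n by (simp add: y_def)
  have "enat (n div 4 - 1) \<le> ct_from (cycle_graph n) x y"
    unfolding ct_from_def
  proof (intro INF_greatest SUP_upper2[OF stay_robber_strategies])
    fix \<sigma> assume \<sigma>: "\<sigma> \<in> cop_strategies (cycle_graph n)"
    have "n div 4 - 1 \<le> t" if "caught \<sigma> stay x y t" for t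
    proof -
      have "min (int (s + L div 2) - int s) (int s + int L - int (s + L div 2)) \<le> int t + 1"
        by (rule caught_imp_distance_le[OF \<sigma> _ _ arc _ _ that])
          (use x y in \<open>auto simp: cop_positions_def y_def zmod_int cong_def\<close>)
      with L show ?thesis by linarith
    qed
    then show "enat (n div 4 - 1) \<le> capture_time \<sigma> stay x y"
      unfolding capture_time_def by (intro INF_greatest) auto
  qed
  also have "\<dots> \<le> (SUP y \<in> verts (cycle_graph n). ct_from (cycle_graph n) x y)"
    using y by (intro SUP_upper) simp
  finally show "enat (n div 4 - 1) \<le> (SUP y \<in> verts (cycle_graph n). ct_from (cycle_graph n) x y)" .
qed

section \<open>Averaging over the initial vertex\<close>

lemma sum_rotate_mod:
  fixes f :: "nat \<Rightarrow> 'a :: comm_monoid_add"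
  shows "(\<Sum>y<n. f y) = (\<Sum>j<n. f ((u + j) mod n))"
proof (cases "n = 0")
  case False
  have "inj_on (\<lambda>j. (u + j) mod n) {..<n}"
  proof (rule inj_onI)
    fix i j assume ij: "i \<in> {..<n}" "j \<in> {..<n}" "(u + i) mod n = (u + j) mod n"
    then have "[i = j] (mod n)"
      using cong_add_lcancel_nat[of u i j n] by (simp add: cong_def)
    with ij show "i = j" by (simp add: cong_def)
  qed
  moreover have "(\<lambda>j. (u + j) mod n) ` {..<n} \<subseteq> {..<n}" using False by auto
  ultimately have "bij_betw (\<lambda>j. (u + j) mod n) {..<n} {..<n}"
    by (simp add: bij_betw_def endo_inj_surj)
  then show ?thesis by (rule sum.reindex_bij_betw[symmetric])
qed simp

lemma sum_lessThan_add:
  fixes f :: "nat \<Rightarrow> 'a :: comm_monoid_add"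
  shows "(\<Sum>j<a + b. f j) = (\<Sum>j<a. f j) + (\<Sum>j<b. f (a + j))"
  by (induction b) (simp_all add: add.assoc)

lemma sum_two_arcs:
  fixes f :: "nat \<Rightarrow> 'a :: comm_monoid_add"
  assumes "u \<le> v" "v \<le> n"
  shows "(\<Sum>y<n. f y) = (\<Sum>j<v - u. f ((u + j) mod n)) + (\<Sum>j<u + n - v. f ((v + j) mod n))"
proof -
  have "(\<Sum>y<n. f y) = (\<Sum>j<(v - u) + (u + n - v). f ((u + j) mod n))"
    using assms by (subst sum_rotate_mod[of _ n u]) simp
  also have "\<dots> = (\<Sum>j<v - u. f ((u + j) mod n)) + (\<Sum>j<u + n - v. f ((u + (v - u + j)) mod n))"
    by (rule sum_lessThan_add)
  finally show ?thesis using assms by (simp add: add.assoc[symmetric])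
qed

text \<open>Passing from \<open>L\<close> to \<open>L + 2\<close> adds a zero term at each end and
  raises each of the old \<open>L + 1\<close> terms by 1; both bounds follow by induction in steps
  of two.\<close>

lemma sum_min_bounds:
  fixes L :: nat
  defines "S \<equiv> \<lambda>L. \<Sum>j\<le>L. min (real j) (real L - real j)"
  shows "((real L)\<^sup>2 - 1) / 4 \<le> S L" "S L \<le> (real L)\<^sup>2 / 4"
proof -
  have S_step: "S (n + 2) = S n + real n + 1" for n
  proof -
    have "S (n + 2) = (\<Sum>j\<le>Suc (Suc n). min (real j) (real (n + 2) - real j))"
      by (simp add: S_def)
    also have "\<dots> = (\<Sum>j\<le>Suc n. min (real (Suc j)) (real (n + 2) - real (Suc j)))"
      by (subst sum.atMost_Suc_shift) simp
    also have "\<dots> = (\<Sum>j\<le>n. min (real j) (real n - real j) + 1)"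
      by (simp add: min_def) (intro sum.cong, auto)
    finally show ?thesis by (simp add: S_def sum.distrib)
  qed
  have "((real L)\<^sup>2 - 1) / 4 \<le> S L \<and> S L \<le> (real L)\<^sup>2 / 4"
  proof (induction L rule: nat_induct2)
    case (step n)
    then show ?case using S_step[of n]
      by (simp add: power2_eq_square field_simps)
  qed (simp_all add: S_def)
  then show "((real L)\<^sup>2 - 1) / 4 \<le> S L" "S L \<le> (real L)\<^sup>2 / 4" by simp_all
qed

text \<open>Passing from \<open>L\<close> to \<open>L + 2\<close> adds one term
  \<open>1 / (L + 3)\<close> at each end. Their sum is at most
  \<open>ln (L + 3) - ln (L + 1)\<close>, by \<open>ln z \<le> z - 1\<close> at the quotient of the
  arguments.\<close>

lemma sum_inverse_distance_le:
  "(\<Sum>j\<le>L. 1 / (\<bar>real L - 2 * real j\<bar> + 1)) \<le> 1 + ln (real L + 1)"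
proof -
  define S where "S L = (\<Sum>j\<le>L. 1 / (\<bar>real L - 2 * real j\<bar> + 1))" for L
  have S_step: "S (n + 2) = S n + 2 / (real n + 3)" for n
  proof -
    have "S (n + 2) = (\<Sum>j\<le>Suc (Suc n). 1 / (\<bar>real (n + 2) - 2 * real j\<bar> + 1))"
      by (simp add: S_def)
    also have "\<dots> = 1 / (real n + 3) + (\<Sum>j\<le>Suc n. 1 / (\<bar>real (n + 2) - 2 * real (Suc j)\<bar> + 1))"
      by (subst sum.atMost_Suc_shift) (simp del: sum.atMost_Suc add: add.commute)
    also have "(\<Sum>j\<le>Suc n. 1 / (\<bar>real (n + 2) - 2 * real (Suc j)\<bar> + 1)) = S n + 1 / (real n + 3)"
      by (simp add: S_def)
    finally show ?thesis by simp
  qed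
  have ln_step: "2 / (real n + 3) \<le> ln (real n + 3) - ln (real n + 1)" for n
  proof -
    have "ln ((real n + 1) / (real n + 3)) \<le> (real n + 1) / (real n + 3) - 1"
      by (rule ln_le_minus_one) simp
    then show ?thesis by (simp add: ln_div field_simps)
  qed
  have "S L \<le> 1 + ln (real L + 1)"
  proof (induction L rule: nat_induct2)
    case (step n)
    then show ?case using S_step[of n] ln_step[of n] by (simp add: add.commute)
  qed (simp_all add: S_def)
  then show ?thesis by (simp add: S_def)
qed

text \<open>Since \<open>D / (D + 1) = 1 - 1 / (D + 1)\<close> and \<open>m - 1 \<le> L\<close>, the
  factor costs at most \<open>L / (D + 1)\<close> per vertex, and summation over the arc makes this
  a harmonic sum.\<close>

lemma sum_arc_ge:
  fixes L :: nat
  shows "(real L)\<^sup>2 / 4 - 1 / 4 - real L - real L * (1 + ln (real L + 1)) \<le>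
    (\<Sum>j<L. (min (real j) (real L - real j) - 1) *
      (\<bar>real L - 2 * real j\<bar> / (\<bar>real L - 2 * real j\<bar> + 1)))"
proof -
  define D where "D j = \<bar>real L - 2 * real j\<bar>" for j
  define m where "m j = min (real j) (real L - real j)" for j
  have le: "m j - 1 - real L * (1 / (D j + 1)) \<le> (m j - 1) * (D j / (D j + 1))" for j
  proof -
    have D: "D j + 1 > 0" by (simp add: D_def add_nonneg_pos)
    have "D j / (D j + 1) = 1 - 1 / (D j + 1)" using D by (simp add: field_simps)
    then have "(m j - 1) * (D j / (D j + 1)) = m j - 1 - (m j - 1) * (1 / (D j + 1))"
      by (simp only: right_diff_distrib mult_1_right)
    moreover have "(m j - 1) * (1 / (D j + 1)) \<le> real L * (1 / (D j + 1))"
      using D by (intro mult_right_mono) (auto simp: m_def)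
    ultimately show ?thesis by linarith
  qed
  \<comment> \<open>The term at \<open>j = L\<close> is 0.\<close>
  have "(\<Sum>j\<le>L. m j) = (\<Sum>j<L. m j)"
    by (simp add: lessThan_Suc_atMost[symmetric] m_def)
  then have 1: "(real L)\<^sup>2 / 4 - 1 / 4 \<le> (\<Sum>j<L. m j)"
    using sum_min_bounds(1)[of L] by (simp add: m_def diff_divide_distrib)
  have "(\<Sum>j<L. 1 / (D j + 1)) \<le> (\<Sum>j\<le>L. 1 / (D j + 1))"
    by (intro sum_mono2) (auto simp: D_def)
  also have "\<dots> \<le> 1 + ln (real L + 1)" unfolding D_def by (rule sum_inverse_distance_le)
  finally have 2: "real L * (\<Sum>j<L. 1 / (D j + 1)) \<le> real L * (1 + ln (real L + 1))"
    by (intro mult_left_mono) auto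
  have "(\<Sum>j<L. m j) - real L - real L * (\<Sum>j<L. 1 / (D j + 1)) = (\<Sum>j<L. m j - 1 - real L * (1 / (D j + 1)))"
    by (simp add: sum_subtractf sum_distrib_left)
  also have "\<dots> \<le> (\<Sum>j<L. (m j - 1) * (D j / (D j + 1)))"
    by (intro sum_mono le)
  finally show ?thesis using 1 2 unfolding m_def D_def by linarith
qed

section \<open>Bounds for the drunk capture time of the cycle\<close>

text \<open>The logarithm is taken at \<open>n\<close> instead of \<open>L\<close>, so that the
  bounds for two complementary arcs can be added.\<close>

lemma sum_dct_from_arc_ge:
  assumes n: "n \<ge> 3" and x: "set x \<subseteq> {0..<n}" and arc: "clear_arc n x (int s) (int s + int L)" and L: "L \<le> n"
  shows "ennreal ((real L)\<^sup>2 / 4 - 1 / 4 - real L - real L * (1 + ln (real n + 1))) \<le>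
    (\<Sum>j<L. dct_from (cycle_graph n) x ((s + j) mod n))"
proof -
  let ?g = "\<lambda>j. (min (real j) (real L - real j) - 1) *
      (\<bar>real L - 2 * real j\<bar> / (\<bar>real L - 2 * real j\<bar> + 1))"
  have ge: "ennreal (?g j) \<le> dct_from (cycle_graph n) x ((s + j) mod n)" if "j < L" for j
  proof -
    have "real_of_int (min (int (s + j) - int s) (int s + int L - int (s + j))) = min (real j) (real L - real j)"
      by (simp add: of_int_min)
    moreover have "real_of_int \<bar>(int s + int L - int (s + j)) - (int (s + j) - int s)\<bar> = \<bar>real L - 2 * real j\<bar>"
      by simp
    ultimately show ?thesis
      using dct_from_ge[OF n(1) _ x arc, of "(s + j) mod n" "int (s + j)"] n L
      by (simp only:) (simp add: cong_def zmod_int)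
  qed
  have "ennreal ((real L)\<^sup>2 / 4 - 1 / 4 - real L - real L * (1 + ln (real n + 1))) \<le> ennreal (\<Sum>j<L. ?g j)"
  proof (rule ennreal_leI, rule order_trans[OF _ sum_arc_ge])
    have "ln (real L + 1) \<le> ln (real n + 1)" using L by simp
    then have "real L * (1 + ln (real L + 1)) \<le> real L * (1 + ln (real n + 1))"
      by (intro mult_left_mono) auto
    then show "(real L)\<^sup>2 / 4 - 1 / 4 - real L - real L * (1 + ln (real n + 1)) \<le>
      (real L)\<^sup>2 / 4 - 1 / 4 - real L - real L * (1 + ln (real L + 1))" by linarith
  qed
  \<comment> \<open>\<open>ennreal\<close> sends negative summands to 0, which can only enlarge the
    sum.\<close>
  also have "\<dots> \<le> ennreal (\<Sum>j<L. max 0 (?g j))"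
    by (intro ennreal_leI sum_mono) simp
  also have "\<dots> = (\<Sum>j<L. ennreal (?g j))"
    by (subst sum_ennreal[symmetric]) (simp_all only: ennreal_max_0 max.cobounded1)
  also have "\<dots> \<le> (\<Sum>j<L. dct_from (cycle_graph n) x ((s + j) mod n))"
    by (intro sum_mono ge) simp
  finally show ?thesis .
qed

text \<open>Truncation at 0 is subadditive. This covers short arcs, whose lower bound may be
  negative.\<close>

lemma ennreal_add_le: "ennreal (a + b) \<le> ennreal a + ennreal b"
proof -
  have "ennreal (a + b) \<le> ennreal (max 0 a + max 0 b)" by (intro ennreal_leI) auto
  also have "\<dots> = ennreal a + ennreal b"
    by (subst ennreal_plus) (auto simp: max_def ennreal_neg)
  finally show ?thesis .
qed

text \<open>By convexity the squares of the two arc lengths sum to at least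
  \<open>n\<^sup>2 / 2\<close>, so every placement of the cops obeys the bound obtained for equal
  arcs.\<close>

lemma dct_cycle_graph_ge:
  assumes n: "n \<ge> 4"
  shows "ennreal (real n / 8 - 3 - ln (real n + 1)) \<le> dct (cycle_graph n)"
  unfolding dct_def cop_number_cycle_graph[OF n] dct_with_def
proof (rule INF_greatest)
  fix x assume x: "x \<in> cop_positions (cycle_graph n) 2"
  then have xv: "set x \<subseteq> {0..<n}" by (simp add: cop_positions_def)
  obtain u v where uv: "u \<le> v" "v < n" "clear_arc n x (int u) (int v)" "clear_arc n x (int v) (int u + int n)"
    using clear_arcs[OF x] .
  define L1 L2 where "L1 = v - u" and "L2 = u + n - v"
  have L: "L1 \<le> n" "L2 \<le> n" "real L1 + real L2 = real n"
    using uv by (auto simp: L1_def L2_def of_nat_diff)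
  define l where "l = 1 + ln (real n + 1)"
  define B where "B L = (real L)\<^sup>2 / 4 - 1 / 4 - real L - real L * l" for L :: nat
  have "real n * (real n / 8 - 3 - ln (real n + 1)) \<le> B L1 + B L2"
  proof -
    have "(real n)\<^sup>2 \<le> 2 * ((real L1)\<^sup>2 + (real L2)\<^sup>2)"
      using zero_le_power2[of "real L1 - real L2"] unfolding L(3)[symmetric]
      by (simp add: power2_eq_square algebra_simps)
    moreover have "B L1 + B L2 = ((real L1)\<^sup>2 + (real L2)\<^sup>2) / 4 - 1 / 2 - (real L1 + real L2) - (real L1 + real L2) * l"
      by (simp add: B_def algebra_simps)
    ultimately have "(real n)\<^sup>2 / 8 - 1 / 2 - real n - real n * l \<le> B L1 + B L2"
      unfolding L(3) by simp
    \<comment> \<open>The constant 3 collects one \<open>n\<close> from the \<open>- 1\<close> in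
      the bound per vertex, one from the 1 inside \<open>l\<close>, and one that absorbs the
      remaining \<open>1 / 2\<close>.\<close>
    moreover have "real n * (real n / 8 - 3 - ln (real n + 1)) = (real n)\<^sup>2 / 8 - real n - real n - real n * l"
      by (simp add: l_def power2_eq_square algebra_simps)
    ultimately show ?thesis using n by linarith
  qed
  then have "ennreal (real n * (real n / 8 - 3 - ln (real n + 1))) \<le> ennreal (B L1) + ennreal (B L2)"
    by (rule order_trans[OF ennreal_leI ennreal_add_le])
  also have "\<dots> \<le> (\<Sum>j<L1. dct_from (cycle_graph n) x ((u + j) mod n)) + (\<Sum>j<L2. dct_from (cycle_graph n) x ((v + j) mod n))"
    unfolding B_def l_def using n xv uv L
    by (intro add_mono sum_dct_from_arc_ge) (auto simp: L1_def L2_def of_nat_diff)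
  also have "\<dots> = (\<Sum>y \<in> verts (cycle_graph n). dct_from (cycle_graph n) x y)"
    unfolding L1_def L2_def using uv by (simp add: sum_two_arcs[of u v n] atLeast0LessThan)
  finally have "ennreal (real n * (real n / 8 - 3 - ln (real n + 1))) / of_nat n \<le>
      (\<Sum>y \<in> verts (cycle_graph n). dct_from (cycle_graph n) x y) / of_nat n"
    by (rule divide_right_mono_ennreal)
  moreover have "ennreal (real n * (real n / 8 - 3 - ln (real n + 1))) / of_nat n = ennreal (real n / 8 - 3 - ln (real n + 1))"
  \<comment> \<open>For a negative bound both sides are truncated to 0.\<close>
  proof (cases "real n / 8 - 3 - ln (real n + 1) \<ge> 0")
    case True
    then show ?thesis using n by (simp add: ennreal_of_nat_eq_real_of_nat divide_ennreal)
  next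
    case False
    then show ?thesis using n by (simp add: ennreal_neg mult_nonneg_nonpos)
  qed
  ultimately show "ennreal (real n / 8 - 3 - ln (real n + 1)) \<le>
      (\<Sum>y \<in> verts (cycle_graph n). dct_from (cycle_graph n) x y) / of_nat (card (verts (cycle_graph n)))"
    by simp
qed

text \<open>Cops \<open>i\<close> and \<open>k\<close> stand at the two ends of the arc, and either
  may chase, so each vertex contributes at most its distance to the nearer end.\<close>

lemma sum_dct_from_arc_le:
  assumes n: "n \<ge> 3" and x: "set x \<subseteq> {0..<n}" and i: "i < length x" "[int (x ! i) = int s] (mod int n)"
    and k: "k < length x" "[int (x ! k) = int s + int L] (mod int n)"
  shows "(\<Sum>j<L. dct_from (cycle_graph n) x ((s + j) mod n)) \<le> ennreal ((real L)\<^sup>2 / 4)"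
proof -
  have le: "dct_from (cycle_graph n) x ((s + j) mod n) \<le> ennreal (min (real j) (real L - real j))" if "j < L" for j
  proof -
    have y: "(s + j) mod n < n" using n by simp
    have c: "[int ((s + j) mod n) = int s + int j] (mod int n)" by (simp add: cong_def zmod_int)
    have "dct_from (cycle_graph n) x ((s + j) mod n) \<le> ennreal (real_of_int (int j))"
      using cong_trans[OF c cong_add[OF cong_sym[OF i(2)] cong_refl]]
      by (intro dct_from_le[OF n y x i(1), of 1]) simp_all
    moreover have "[int s + int j = int (x ! k) - (int L - int j)] (mod int n)"
      using cong_diff[OF cong_sym[OF k(2)] cong_refl, of "int L - int j"] by simp
    then have "[int s + int j = int (x ! k) + -1 * (int L - int j)] (mod int n)"
      by (simp only: mult_minus1 add_uminus_conv_diff)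
    from dct_from_le[OF n y x k(1) _ _ cong_trans[OF c this]] that
    have "dct_from (cycle_graph n) x ((s + j) mod n) \<le> ennreal (real_of_int (int L - int j))"
      by simp
    ultimately show ?thesis by (simp add: min_def)
  qed
  have "(\<Sum>j<L. dct_from (cycle_graph n) x ((s + j) mod n)) \<le> (\<Sum>j<L. ennreal (min (real j) (real L - real j)))"
    by (intro sum_mono le) simp
  also have "\<dots> = ennreal (\<Sum>j\<le>L. min (real j) (real L - real j))"
    by (subst sum_ennreal) (auto simp: lessThan_Suc_atMost[symmetric])
  also have "\<dots> \<le> ennreal ((real L)\<^sup>2 / 4)" by (intro ennreal_leI sum_min_bounds(2))
  finally show ?thesis .
qed

lemma dct_cycle_graph_le:
  assumes n: "n \<ge> 4"
  shows "dct (cycle_graph n) \<le> ennreal ((real n + 1) / 8)"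
proof -
  define h where "h = n div 2"
  define k where "k = n - h"
  let ?x = "[0, h]"
  have h: "h \<le> n" "k + h = n" by (auto simp: h_def k_def)
  have x: "?x \<in> cop_positions (cycle_graph n) 2"
    unfolding h_def using n by (intro cop_positions_antipodal) simp
  then have xv: "set ?x \<subseteq> {0..<n}" by (simp add: cop_positions_def)
  have "(\<Sum>y \<in> verts (cycle_graph n). dct_from (cycle_graph n) ?x y) =
     (\<Sum>j<h. dct_from (cycle_graph n) ?x ((0 + j) mod n)) + (\<Sum>j<k. dct_from (cycle_graph n) ?x ((h + j) mod n))"
    using h by (simp add: sum_two_arcs[of 0 h n] atLeast0LessThan k_def)
  also have "\<dots> \<le> ennreal ((real h)\<^sup>2 / 4) + ennreal ((real k)\<^sup>2 / 4)"
  proof (rule add_mono)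
    show "(\<Sum>j<h. dct_from (cycle_graph n) ?x ((0 + j) mod n)) \<le> ennreal ((real h)\<^sup>2 / 4)"
      using n xv by (intro sum_dct_from_arc_le[where i=0 and k=1]) auto
    \<comment> \<open>The far end of this arc is \<open>h + k = n\<close>, where the cop at
      \<open>0\<close> stands.\<close>
    show "(\<Sum>j<k. dct_from (cycle_graph n) ?x ((h + j) mod n)) \<le> ennreal ((real k)\<^sup>2 / 4)"
      using n xv h by (intro sum_dct_from_arc_le[where i=1 and k=0]) (auto simp: cong_def k_def of_nat_diff)
  qed
  also have "\<dots> = ennreal (((real h)\<^sup>2 + (real k)\<^sup>2) / 4)"
    by (subst ennreal_plus[symmetric]) (auto simp: add_divide_distrib)
  also have "\<dots> \<le> ennreal (real n * ((real n + 1) / 8))"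
  proof (rule ennreal_leI)
    have "k = h \<or> k = h + 1" unfolding h_def k_def by presburger
    then have hk: "real k = real h \<or> real k = real h + 1" by auto
    have "real n = real k + real h" using h(2) by linarith
    \<comment> \<open>The claim amounts to \<open>(k - h)\<^sup>2 \<le> n\<close>, and
      \<open>k\<close> exceeds \<open>h\<close> by at most 1.\<close>
    then show "((real h)\<^sup>2 + (real k)\<^sup>2) / 4 \<le> real n * ((real n + 1) / 8)"
      using hk by (auto simp: power2_eq_square field_simps)
  qed
  finally have "(\<Sum>y \<in> verts (cycle_graph n). dct_from (cycle_graph n) ?x y) / of_nat n \<le>
      ennreal (real n * ((real n + 1) / 8)) / of_nat n"
    by (rule divide_right_mono_ennreal)
  also have "\<dots> = ennreal ((real n + 1) / 8)"
    using n by (simp add: ennreal_of_nat_eq_real_of_nat divide_ennreal)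
  finally show ?thesis
    unfolding dct_def cop_number_cycle_graph[OF n] dct_with_def
    using x by (intro INF_lower2[OF x]) simp
qed

theorem theorem3p3:
  shows "(\<exists>\<epsilon> :: nat \<Rightarrow> real. \<epsilon> \<in> O(\<lambda>n. ln (real n) / real n) \<and>
           (\<forall>n\<ge>4. ennreal (real n / 8 * (1 - \<epsilon> n)) \<le> dct (cycle_graph n) \<and>
                  dct (cycle_graph n) \<le> ennreal ((real n + 1) / 8))) \<and>
         (\<lambda>n. enn2real (dct (cycle_graph n))) \<sim>[at_top] (\<lambda>n. real n / 8) \<and>
         (\<lambda>n. cost_of_drunkenness (cycle_graph n)) \<longlonglongrightarrow> 2"
proof (intro conjI)
  \<comment> \<open>The upper bounds make both quantities finite for \<open>n \<ge> 4\<close>, so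
    \<open>enn2real\<close> and \<open>the_enat\<close> lose nothing there.\<close>
  define d where "d n = enn2real (dct (cycle_graph n))" for n
  define c where "c n = the_enat (ct (cycle_graph n))" for n
  have d: "dct (cycle_graph n) = ennreal (d n)" "real n / 8 - 3 - ln (real n + 1) \<le> d n" "d n \<le> (real n + 1) / 8"
    if n: "n \<ge> 4" for n
  proof -
    have "dct (cycle_graph n) < top"
      using dct_cycle_graph_le[OF n] by (rule le_less_trans) simp
    then show *: "dct (cycle_graph n) = ennreal (d n)" by (simp add: d_def)
    have "0 \<le> d n" by (simp add: d_def)
    then show "real n / 8 - 3 - ln (real n + 1) \<le> d n"
      using dct_cycle_graph_ge[OF n] unfolding * by (simp add: ennreal_le_iff)
    show "d n \<le> (real n + 1) / 8"
      using dct_cycle_graph_le[OF n] unfolding * by (simp add: ennreal_le_iff)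
  qed
  have c: "ct (cycle_graph n) = enat (c n)" "real n / 4 - 2 \<le> real (c n)" "real (c n) \<le> real n / 4 + 1"
    if n: "n \<ge> 4" for n
  proof -
    show *: "ct (cycle_graph n) = enat (c n)"
      using ct_cycle_graph_le[OF n] unfolding c_def by (cases "ct (cycle_graph n)") auto
    have "n div 4 - 1 \<le> c n" "c n \<le> n div 4 + 1"
      using ct_cycle_graph_le[OF n] ct_cycle_graph_ge[OF n] unfolding * by simp_all
    then show "real n / 4 - 2 \<le> real (c n)" "real (c n) \<le> real n / 4 + 1" by linarith+
  qed
  have dlim: "(\<lambda>n. d n / (real n / 8)) \<longlonglongrightarrow> 1"
  proof (rule tendsto_sandwich)
    show "(\<lambda>n. (real n / 8 - 3 - ln (real n + 1)) / (real n / 8)) \<longlonglongrightarrow> 1"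
      "(\<lambda>n. ((real n + 1) / 8) / (real n / 8)) \<longlonglongrightarrow> 1" by real_asymp+
    show "\<forall>\<^sub>F n in sequentially. (real n / 8 - 3 - ln (real n + 1)) / (real n / 8) \<le> d n / (real n / 8)"
      "\<forall>\<^sub>F n in sequentially. d n / (real n / 8) \<le> ((real n + 1) / 8) / (real n / 8)"
      using eventually_ge_at_top[of 4] by (eventually_elim; intro divide_right_mono d; simp)+
  qed
  have clim: "(\<lambda>n. c n / (real n / 8)) \<longlonglongrightarrow> 2"
  proof (rule tendsto_sandwich)
    show "(\<lambda>n. (real n / 4 - 2) / (real n / 8)) \<longlonglongrightarrow> 2"
      "(\<lambda>n. (real n / 4 + 1) / (real n / 8)) \<longlonglongrightarrow> 2" by real_asymp+
    show "\<forall>\<^sub>F n in sequentially. (real n / 4 - 2) / (real n / 8) \<le> c n / (real n / 8)"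
      "\<forall>\<^sub>F n in sequentially. c n / (real n / 8) \<le> (real n / 4 + 1) / (real n / 8)"
      using eventually_ge_at_top[of 4] by (eventually_elim; intro divide_right_mono c; simp)+
  qed
  show "\<exists>\<epsilon> :: nat \<Rightarrow> real. \<epsilon> \<in> O(\<lambda>n. ln (real n) / real n) \<and>
           (\<forall>n\<ge>4. ennreal (real n / 8 * (1 - \<epsilon> n)) \<le> dct (cycle_graph n) \<and>
                  dct (cycle_graph n) \<le> ennreal ((real n + 1) / 8))"
  proof (intro exI conjI allI impI)
    \<comment> \<open>The witness is the error of the lower bound relative to
      \<open>n / 8\<close>.\<close>
    show "(\<lambda>n. 8 * (3 + ln (real n + 1)) / real n) \<in> O(\<lambda>n. ln (real n) / real n)" by real_asymp
    fix n :: nat assume n: "n \<ge> 4"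
    then have "real n / 8 * (1 - 8 * (3 + ln (real n + 1)) / real n) = real n / 8 - 3 - ln (real n + 1)"
      by (simp add: field_simps)
    then show "ennreal (real n / 8 * (1 - 8 * (3 + ln (real n + 1)) / real n)) \<le> dct (cycle_graph n)"
      using dct_cycle_graph_ge[OF n] by (simp only:)
    show "dct (cycle_graph n) \<le> ennreal ((real n + 1) / 8)" by (rule dct_cycle_graph_le[OF n])
  qed
  show "(\<lambda>n. enn2real (dct (cycle_graph n))) \<sim>[at_top] (\<lambda>n. real n / 8)"
    using dlim unfolding d_def by (rule asymp_equivI')
  have pos: "\<forall>\<^sub>F n in sequentially. d n / (real n / 8) > 0"
    using order_tendstoD(1)[OF dlim, of 0] by simp
  have "(\<lambda>n. (c n / (real n / 8)) / (d n / (real n / 8))) \<longlonglongrightarrow> 2 / 1"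
    by (intro tendsto_divide clim dlim) simp
  then have "(\<lambda>n. ennreal ((c n / (real n / 8)) / (d n / (real n / 8)))) \<longlonglongrightarrow> ennreal (2 / 1)"
    by (rule tendsto_ennrealI)
  \<comment> \<open>Division in \<open>ennreal\<close> agrees with real division once
    \<open>d n\<close> is positive, which holds eventually because \<open>d n / (n / 8)\<close>
    tends to 1.\<close>
  moreover have "\<forall>\<^sub>F n in sequentially. ennreal ((c n / (real n / 8)) / (d n / (real n / 8))) = cost_of_drunkenness (cycle_graph n)"
    using pos eventually_ge_at_top[of 4]
  proof eventually_elim
    case (elim n)
    then have "d n > 0" by (simp add: zero_less_divide_iff)
    with elim show ?case
      by (simp add: cost_of_drunkenness_def c d(1) ennreal_of_nat_eq_real_of_nat divide_ennreal)
  qed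
  ultimately have "(\<lambda>n. cost_of_drunkenness (cycle_graph n)) \<longlonglongrightarrow> ennreal (2 / 1)"
    by (rule Lim_transform_eventually)
  then show "(\<lambda>n. cost_of_drunkenness (cycle_graph n)) \<longlonglongrightarrow> 2" by simp
qed

end
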